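(* Let $k$ be a field of characteristic $p>0$, let $G \le \mathcal{S}_n$ be a $p$-group acting on $S = k[x_1,\ldots,x_n]$ via permutations of the variables, and suppose that the inclusion $S^G\hookrightarrow S$ splits $S^G$-linearly. Then $S^G$ is a polynomial ring.
   Context: $G\le\mathcal{S}_n$ acts on $S$ by $k$-algebra automorphisms with $\sigma\cdot x_i=x_{\sigma(i)}$, and $S^G$ is the invariant subring. "Polynomial ring" means a polynomial ring over $k$. *)

theory Defs
  imports
    "HOL-Library.Poly_Mapping"
    "HOL-Computational_Algebra.Computational_Algebra"
    "HOL-Algebra.Sym_Groups"
begin

text \<open>
  A monomial is a finitely supported exponent vector \<open>nat \<Rightarrow>\<^sub>0 nat\<close>, and a polynomial over \<open>'k\<close>
  is a finitely supported family of coefficients indexed by monomials. The ring structure of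
  \<open>'k mpoly\<close> is the convolution structure of \<open>Poly_Mapping\<close>.
\<close>

type_synonym 'k mpoly = "(nat \<Rightarrow>\<^sub>0 nat) \<Rightarrow>\<^sub>0 'k"

definition Const :: "'k::comm_ring_1 \<Rightarrow> 'k mpoly" where
  "Const c = Poly_Mapping.single 0 c"

definition Var :: "nat \<Rightarrow> 'k::comm_ring_1 mpoly" where
  "Var i = Poly_Mapping.single (Poly_Mapping.single i 1) 1"

text \<open>\<open>k[x\<^sub>1, \<dots>, x\<^sub>n]\<close>, as the subring of \<open>'k mpoly\<close> of polynomials in which only
  variables with index in \<open>{1..n}\<close> occur.\<close>

definition polys :: "nat \<Rightarrow> 'k::comm_ring_1 mpoly set" where
  "polys n = {f. \<forall>m\<in>Poly_Mapping.keys f. Poly_Mapping.keys m \<subseteq> {1..n}}"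

text \<open>The value of \<open>f\<close> under the \<open>k\<close>-algebra homomorphism that sends \<open>Var i\<close> to \<open>y i\<close>.\<close>

definition subst :: "(nat \<Rightarrow> 'k::comm_ring_1 mpoly) \<Rightarrow> 'k mpoly \<Rightarrow> 'k mpoly" where
  "subst y f = (\<Sum>m\<in>Poly_Mapping.keys f.
     Const (Poly_Mapping.lookup f m) *
     (\<Prod>i\<in>Poly_Mapping.keys m. y i ^ Poly_Mapping.lookup m i))"

definition perm_act :: "(nat \<Rightarrow> nat) \<Rightarrow> 'k::comm_ring_1 mpoly \<Rightarrow> 'k mpoly" where
  "perm_act \<sigma> = subst (\<lambda>i. Var (\<sigma> i))"

lemma perm_act_Var: "perm_act \<sigma> (Var i) = Var (\<sigma> i)"
  by (simp add: perm_act_def subst_def Var_def Const_def Poly_Mapping.mult_single)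

definition invariants :: "nat \<Rightarrow> (nat \<Rightarrow> nat) set \<Rightarrow> 'k::comm_ring_1 mpoly set" where
  "invariants n G = {f \<in> polys n. \<forall>\<sigma>\<in>G. perm_act \<sigma> f = f}"

text \<open>For a subring \<open>R\<close> of a ring \<open>S\<close>, both given by their carriers: there is an
  \<open>R\<close>-linear map \<open>S \<rightarrow> R\<close> that restricts to the identity on \<open>R\<close>.\<close>

definition inclusion_splits :: "'a::comm_ring_1 set \<Rightarrow> 'a set \<Rightarrow> bool" where
  "inclusion_splits R S \<longleftrightarrow> (\<exists>\<rho>.
     (\<forall>f\<in>S. \<rho> f \<in> R) \<and>
     (\<forall>f\<in>S. \<forall>g\<in>S. \<rho> (f + g) = \<rho> f + \<rho> g) \<and>
     (\<forall>r\<in>R. \<forall>f\<in>S. \<rho> (r * f) = r * \<rho> f) \<and>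
     (\<forall>r\<in>R. \<rho> r = r))"

text \<open>For \<open>k\<close>-subalgebras \<open>A\<close> and \<open>B\<close> of \<open>'k mpoly\<close>. Compatibility with constants makes a
  multiplicative map \<open>k\<close>-linear and unital.\<close>

definition k_algebra_iso :: "('k::comm_ring_1 mpoly \<Rightarrow> 'k mpoly) \<Rightarrow> 'k mpoly set \<Rightarrow> 'k mpoly set \<Rightarrow> bool" where
  "k_algebra_iso \<phi> A B \<longleftrightarrow>
     bij_betw \<phi> A B \<and>
     (\<forall>f\<in>A. \<forall>g\<in>A. \<phi> (f + g) = \<phi> f + \<phi> g) \<and>
     (\<forall>f\<in>A. \<forall>g\<in>A. \<phi> (f * g) = \<phi> f * \<phi> g) \<and>
     (\<forall>c. \<phi> (Const c) = Const c)"

definition is_polynomial_ring :: "'k::comm_ring_1 mpoly set \<Rightarrow> bool" where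
  "is_polynomial_ring A \<longleftrightarrow> (\<exists>m \<phi>. k_algebra_iso \<phi> (polys m) A)"

end

theory Submission
  imports Defs "HOL-Algebra.Multiplicative_Group"
begin

text \<open>
  The transpositions in \<open>G\<close> are its only reflections: every other nontrivial element fixes a
  subspace of codimension at least two. Let \<open>T\<close> be the normal subgroup that they generate and
  \<open>R = S\<^sup>T\<close>. It turns out that a splitting forces \<open>G = T\<close>, and that \<open>S\<^sup>T\<close> is a polynomial ring.

  For the first point, \<open>G\<close> acts on \<open>R\<close> through a finite group \<open>Q\<close>, and the splitting restricts to an
  \<open>R\<^sup>Q\<close>-linear map \<open>\<rho> : R \<rightarrow> R\<^sup>Q\<close> with \<open>\<rho> 1 = 1\<close>. On the fraction field every linear map to the fixed
  field is of the form \<open>f \<mapsto> Tr (a f)\<close>. Denominators are controlled explicitly: for any choice of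
  \<open>v\<^sub>q \<in> R\<close>, the element \<open>d = \<Prod> (q v\<^sub>q - v\<^sub>q)\<close> over \<open>q \<noteq> 1\<close> satisfies \<open>\<rho> (d f) = Tr (c f)\<close> with some
  \<open>c \<in> R\<close> (\<open>splitting_as_trace\<close>), so that \<open>a = c / d\<close>. Since \<open>a\<close> does not depend on the choice,
  two choices without a common prime factor give \<open>a \<in> R\<close> (\<open>splitting_imp_trace_one\<close>); this is
  where the absence of reflections in \<open>Q\<close> enters. Indeed, sum and product of the variables of a
  \<open>T\<close>-orbit (a block) are in \<open>R\<close>. The differences of two block sums are prime linear forms
  (\<open>prime_block_sum_diff\<close>), and for each such form and each nontrivial \<open>q\<close> some \<open>q w - w\<close> avoids it
  (\<open>avoid_block_sum_diff\<close>). Now \<open>Tr a = \<rho> 1 = 1\<close>, but the constant term of \<open>Tr a\<close> is \<open>|Q|\<close> times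
  that of \<open>a\<close>, and \<open>|Q|\<close> is a power of the characteristic. Hence \<open>Q\<close> is trivial
  (\<open>splitting_imp_blockwise\<close>), and \<open>S\<^sup>G = R\<close>.

  For the second point, two transpositions of a \<open>p\<close>-group that overlap in one letter would give it
  elements of orders 2 and 3, so all transpositions of \<open>G\<close> are disjoint. The invariants of a single
  transposition \<open>(a b)\<close> are freely generated by \<open>x\<^sub>a + x\<^sub>b\<close>, \<open>x\<^sub>a x\<^sub>b\<close> and the other variables,
  and disjoint transpositions can be treated one after the other
  (\<open>invariants_disjoint_transpositions\<close>).
\<close>

section \<open>Substitution homomorphisms\<close>

lemma Const_hom:
  "Const 0 = 0" "Const 1 = 1" "Const (a + b) = Const a + Const b" "Const (a * b) = Const a * Const b"
  by (simp_all add: Const_def single_add mult_single)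

lemma Const_of_nat: "Const (of_nat k) = of_nat k"
  by (induction k) (simp_all add: Const_hom)

definition power_product :: "(nat \<Rightarrow> 'k::comm_ring_1 mpoly) \<Rightarrow> (nat \<Rightarrow>\<^sub>0 nat) \<Rightarrow> 'k mpoly" where
  "power_product y m = (\<Prod>i\<in>Poly_Mapping.keys m. y i ^ Poly_Mapping.lookup m i)"

lemma power_product_superset:
  assumes "finite A" "Poly_Mapping.keys m \<subseteq> A"
  shows "power_product y m = (\<Prod>i\<in>A. y i ^ Poly_Mapping.lookup m i)"
  unfolding power_product_def using assms
  by (intro prod.mono_neutral_left) (auto simp: in_keys_iff)

lemma power_product_add: "power_product y (m + m') = power_product y m * power_product y m'"
proof -
  let ?A = "Poly_Mapping.keys m \<union> Poly_Mapping.keys m'"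
  have "Poly_Mapping.keys (m + m') \<subseteq> ?A" by (rule keys_add)
  then show ?thesis
    by (simp add: power_product_superset[of ?A] lookup_add power_add prod.distrib)
qed

lemma subst_superset:
  assumes "finite A" "Poly_Mapping.keys f \<subseteq> A"
  shows "subst y f = (\<Sum>m\<in>A. Const (Poly_Mapping.lookup f m) * power_product y m)"
  unfolding subst_def power_product_def[symmetric] using assms
  by (intro sum.mono_neutral_left) (auto simp: in_keys_iff Const_hom)

lemma subst_add: "subst y (f + g) = subst y f + subst y g"
proof -
  let ?A = "Poly_Mapping.keys f \<union> Poly_Mapping.keys g"
  have "Poly_Mapping.keys (f + g) \<subseteq> ?A" by (rule keys_add)
  then show ?thesis
    by (simp add: subst_superset[of ?A] lookup_add Const_hom algebra_simps sum.distrib)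
qed

lemma subst_0: "subst y 0 = 0"
  by (simp add: subst_def)

lemma subst_sum: "subst y (\<Sum>i\<in>I. f i) = (\<Sum>i\<in>I. subst y (f i))"
  by (induction I rule: infinite_finite_induct) (simp_all add: subst_0 subst_add)

lemma subst_minus: "subst y (- f) = - subst y f"
  by (metis add_eq_0_iff neg_eq_iff_add_eq_0 subst_0 subst_add)

lemma subst_diff: "subst y (f - g) = subst y f - subst y g"
  using subst_add[of y f "- g"] by (simp add: subst_minus)

lemma subst_single: "subst y (Poly_Mapping.single m c) = Const c * power_product y m"
  using subst_superset[of "{m}" "Poly_Mapping.single m c" y] by simp

lemma sum_singles: "f = (\<Sum>m\<in>Poly_Mapping.keys f. Poly_Mapping.single m (Poly_Mapping.lookup f m))"
  by (rule poly_mapping_eqI) (simp add: lookup_sum lookup_single when_def in_keys_iff)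

lemma subst_mult: "subst y (f * g) = subst y f * subst y g"
proof -
  let ?c = "Poly_Mapping.lookup"
  have "f * g = (\<Sum>m\<in>Poly_Mapping.keys f. \<Sum>m'\<in>Poly_Mapping.keys g.
      Poly_Mapping.single (m + m') (?c f m * ?c g m'))"
    by (subst sum_singles[of f], subst sum_singles[of g]) (simp add: sum_product mult_single)
  then have "subst y (f * g) = (\<Sum>m\<in>Poly_Mapping.keys f. \<Sum>m'\<in>Poly_Mapping.keys g.
      (Const (?c f m) * power_product y m) * (Const (?c g m') * power_product y m'))"
    by (simp only: subst_sum subst_single Const_hom power_product_add) (simp add: algebra_simps)
  then show ?thesis
    by (simp only: subst_def power_product_def[symmetric] sum_product)
qed

lemma subst_Const: "subst y (Const c) = Const c"
  by (simp add: Const_def subst_single power_product_def)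

lemma subst_1: "subst y 1 = 1"
  using subst_Const[of y 1] by (simp add: Const_hom)

lemma subst_Var: "subst y (Var i) = y i"
  unfolding Var_def by (simp add: subst_single power_product_def Const_hom)

lemma subst_power: "subst y (f ^ k) = subst y f ^ k"
  by (induction k) (simp_all add: subst_1 subst_mult)

lemma subst_prod: "subst y (\<Prod>i\<in>I. f i) = (\<Prod>i\<in>I. subst y (f i))"
  by (induction I rule: infinite_finite_induct) (simp_all add: subst_1 subst_mult)

lemmas subst_hom = subst_0 subst_1 subst_add subst_minus subst_diff subst_mult subst_Const subst_Var
  subst_power subst_sum subst_prod

lemma subst_subst: "subst y (subst z f) = subst (\<lambda>i. subst y (z i)) f"
  by (simp add: subst_def[of z] subst_def[of "\<lambda>i. subst y (z i)"] subst_hom)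

lemma Var_power: "Var i ^ k = Poly_Mapping.single (Poly_Mapping.single i k) 1"
  by (induction k) (simp_all add: Var_def mult_single single_add[symmetric])

lemma subst_Var_id: "subst Var f = f"
proof -
  have "power_product Var m = Poly_Mapping.single m (1::'a)" for m
  proof -
    have "(\<Prod>i\<in>A. Var i ^ Poly_Mapping.lookup m i) =
        Poly_Mapping.single (\<Sum>i\<in>A. Poly_Mapping.single i (Poly_Mapping.lookup m i)) (1::'a)" for A
      by (induction A rule: infinite_finite_induct) (simp_all add: Var_power mult_single)
    then show ?thesis by (simp add: power_product_def sum_singles[symmetric])
  qed
  then show ?thesis
    by (simp add: subst_def power_product_def[symmetric] Const_def mult_single sum_singles[symmetric])
qed

text \<open>This substitution turns membership in a subring of \<open>'k mpoly\<close> into a fixed point equation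
  (\<open>polys_iff\<close>), just as for invariants. Closure under ring operations, and under division in
  \<open>'k mpoly\<close>, is then immediate for \<open>polys n\<close> and for its subrings of invariants.\<close>
definition restrict_vars :: "nat \<Rightarrow> nat \<Rightarrow> 'k::comm_ring_1 mpoly" where
  "restrict_vars n i = (if i \<in> {1..n} then Var i else 0)"

lemma polys_subst:
  assumes "f \<in> polys n" "\<And>i. i \<in> {1..n} \<Longrightarrow> y i = z i"
  shows "subst y f = subst z f"
proof -
  have "y i = z i" if "m \<in> Poly_Mapping.keys f" "i \<in> Poly_Mapping.keys m" for m i
    using assms that by (fastforce simp: polys_def)
  then show ?thesis unfolding subst_def by (simp cong: sum.cong prod.cong)
qed

lemma subring_contains_polys:
  assumes "f \<in> polys n"
    and C: "\<And>c. Const c \<in> A" and V: "\<And>i. i \<in> {1..n} \<Longrightarrow> Var i \<in> A"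
    and add: "\<And>f g. f \<in> A \<Longrightarrow> g \<in> A \<Longrightarrow> f + g \<in> A"
    and mult: "\<And>f g. f \<in> A \<Longrightarrow> g \<in> A \<Longrightarrow> f * g \<in> A"
  shows "f \<in> A"
proof -
  have one: "1 \<in> A" and zero: "0 \<in> A" using C[of 1] C[of 0] by (simp_all add: Const_hom)
  have sum: "(\<And>i. i \<in> I \<Longrightarrow> h i \<in> A) \<Longrightarrow> (\<Sum>i\<in>I. h i) \<in> A" for I :: "(nat \<Rightarrow>\<^sub>0 nat) set" and h
    by (induction I rule: infinite_finite_induct) (auto simp: zero add)
  have pow: "g \<in> A \<Longrightarrow> g ^ k \<in> A" for g and k :: nat
    by (induction k) (auto simp: one mult)
  have prod: "(\<And>i. i \<in> I \<Longrightarrow> h i \<in> A) \<Longrightarrow> (\<Prod>i\<in>I. h i) \<in> A" for I :: "nat set" and h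
    by (induction I rule: infinite_finite_induct) (auto simp: one mult)
  have "subst Var f \<in> A"
    unfolding subst_def using assms(1) unfolding polys_def
    by (intro sum mult C prod pow V) blast
  then show ?thesis by (simp add: subst_Var_id)
qed

lemma polys_iff: "f \<in> polys n \<longleftrightarrow> subst (restrict_vars n) f = f"
proof
  assume "f \<in> polys n"
  then show "subst (restrict_vars n) f = f"
    using polys_subst[of f n "restrict_vars n" Var] by (simp add: restrict_vars_def subst_Var_id)
next
  have P: "power_product (restrict_vars n) m \<in> {0, Poly_Mapping.single m (1::'a)} \<and>
      (\<not> Poly_Mapping.keys m \<subseteq> {1..n} \<longrightarrow> power_product (restrict_vars n) m = (0::'a mpoly))" for m
  proof (cases "Poly_Mapping.keys m \<subseteq> {1..n}")
    case True
    then have "power_product (restrict_vars n) m = (power_product Var m :: 'a mpoly)"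
      unfolding power_product_def by (intro prod.cong) (auto simp: restrict_vars_def)
    also have "\<dots> = Poly_Mapping.single m 1"
      using subst_Var_id[of "Poly_Mapping.single m (1::'a)"] by (simp add: subst_single Const_hom)
    finally show ?thesis using True by simp
  next
    case False
    then obtain i where "i \<in> Poly_Mapping.keys m" "i \<notin> {1..n}" by blast
    then have "power_product (restrict_vars n) m = (0::'a mpoly)"
      unfolding power_product_def
      by (intro prod_zero bexI[of _ i]) (auto simp: restrict_vars_def in_keys_iff zero_power)
    then show ?thesis by simp
  qed
  assume f: "subst (restrict_vars n) f = f"
  have "Poly_Mapping.keys m \<subseteq> {1..n}" if "m \<in> Poly_Mapping.keys f" for m
  proof (rule ccontr)
    assume m: "\<not> Poly_Mapping.keys m \<subseteq> {1..n}"
    have "Poly_Mapping.lookup (Const c * power_product (restrict_vars n) m') m = 0" for c :: 'a and m'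
    proof (cases "m' = m")
      case True
      then show ?thesis using P[of m] m by simp
    next
      case False
      then show ?thesis using P[of m'] by (auto simp: Const_def mult_single lookup_single)
    qed
    then have "Poly_Mapping.lookup (subst (restrict_vars n) f) m = 0"
      by (simp add: subst_def power_product_def[symmetric] lookup_sum)
    then show False using that f by (simp add: in_keys_iff)
  qed
  then show "f \<in> polys n" by (simp add: polys_def)
qed

lemma Var_power_dvd_imp:
  assumes "Var b ^ k dvd f" "m \<in> Poly_Mapping.keys f"
  shows "k \<le> Poly_Mapping.lookup m b"
proof -
  obtain g where f: "f = Poly_Mapping.single (Poly_Mapping.single b k) 1 * g"
    using assms(1) by (auto simp: Var_power)
  have "m \<in> {a + c |a c. a \<in> Poly_Mapping.keys (Poly_Mapping.single (Poly_Mapping.single b k) (1::'a)) \<and> c \<in> Poly_Mapping.keys g}"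
    using assms(2) keys_mult unfolding f by blast
  then show ?thesis by (auto simp: lookup_add lookup_single)
qed

lemma dvd_power_diff:
  fixes l :: "'a::comm_ring_1"
  assumes "l dvd a - b" shows "l dvd a ^ k - b ^ k"
proof (induction k)
  case (Suc k)
  have "a ^ Suc k - b ^ Suc k = a * (a ^ k - b ^ k) + (a - b) * b ^ k" by (simp add: algebra_simps)
  then show ?case using Suc assms by simp
qed simp

lemma dvd_prod_diff:
  fixes l :: "'a::comm_ring_1"
  assumes "\<And>i. l dvd a i - b i" shows "l dvd (\<Prod>i\<in>A. a i) - (\<Prod>i\<in>A. b i)"
proof (induction A rule: infinite_finite_induct)
  case (insert i A)
  have "(\<Prod>i\<in>insert i A. a i) - (\<Prod>i\<in>insert i A. b i)
      = a i * ((\<Prod>i\<in>A. a i) - (\<Prod>i\<in>A. b i)) + (a i - b i) * (\<Prod>i\<in>A. b i)"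
    using insert by (simp add: algebra_simps)
  then show ?case using insert assms by simp
qed simp_all

lemma dvd_subst_diff:
  assumes "\<And>i. l dvd y i - z i"
  shows "l dvd subst y f - subst z f"
  unfolding subst_def sum_subtractf[symmetric] right_diff_distrib[symmetric]
  by (intro dvd_sum dvd_mult dvd_prod_diff dvd_power_diff assms)

text \<open>Substitution by \<open>y\<close> has \<open>l\<close> in its kernel and is the identity modulo \<open>l\<close>; hence its kernel is
  exactly the ideal of \<open>l\<close>, and this ideal is prime because the target is a domain.\<close>
lemma prime_elem_linear:
  fixes l :: "'k::idom mpoly"
  assumes "l \<noteq> 0" "\<And>i. l dvd y i - Var i" "subst y l = 0"
  shows "prime_elem l"
proof -
  have iff: "l dvd f \<longleftrightarrow> subst y f = 0" for f
  proof
    assume "l dvd f" then show "subst y f = 0" using assms(3) by (auto simp: subst_mult)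
  next
    assume "subst y f = 0"
    then show "l dvd f" using dvd_subst_diff[of l y Var f] assms(2) by (simp add: subst_Var_id)
  qed
  show ?thesis using assms(1) by (auto simp: prime_elem_def iff subst_1 subst_mult)
qed

section \<open>Splittings and traces for finite group actions\<close>

lemma prime_elem_dvd_prodE:
  fixes l :: "'a::idom"
  assumes "prime_elem l" "finite I" "l dvd (\<Prod>i\<in>I. h i)"
  obtains i where "i \<in> I" "l dvd h i"
proof -
  have "\<exists>i\<in>I. l dvd h i" using assms(2,3)
  proof (induction I rule: finite_induct)
    case empty
    then show ?case using assms(1) by (simp add: prime_elem_def)
  next
    case (insert i I)
    then show ?case using assms(1) by (auto simp: prime_elem_dvd_mult_iff)
  qed
  then show ?thesis using that by blast
qed

text \<open>A fraction \<open>c / \<Prod> l\<^sub>i\<close> in which every \<open>l\<^sub>i\<close> is prime, and that for each \<open>i\<close> has another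
  denominator \<open>d\<close> prime to \<open>l\<^sub>i\<close>, is integral: the primes cancel one at a time.\<close>
lemma prime_prod_dvd:
  fixes c :: "'a::idom"
  assumes "finite I"
    and "\<And>i. i \<in> I \<Longrightarrow> prime_elem (l i)"
    and "\<And>i. i \<in> I \<Longrightarrow> \<exists>d c'. \<not> l i dvd d \<and> c * d = c' * (\<Prod>j\<in>I. l j)"
  shows "(\<Prod>j\<in>I. l j) dvd c"
  using assms
proof (induction I arbitrary: c rule: finite_induct)
  case (insert i I)
  obtain d c' where d: "\<not> l i dvd d" "c * d = c' * (\<Prod>j\<in>insert i I. l j)"
    using insert.prems(2)[of i] by blast
  then have "l i dvd c * d" using insert.hyps by simp
  then have "l i dvd c" using insert.prems(1)[of i] d(1) by (simp add: prime_elem_dvd_mult_iff)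
  then obtain b where c: "c = l i * b" by blast
  have l0: "l i \<noteq> 0" using insert.prems(1)[of i] by auto
  have "(\<Prod>j\<in>I. l j) dvd b"
  proof (rule insert.IH)
    fix j assume j: "j \<in> I"
    then obtain d c' where "\<not> l j dvd d" "c * d = c' * (\<Prod>j\<in>insert i I. l j)"
      using insert.prems(2)[of j] by blast
    moreover from this(2) have "l i * (b * d) = l i * (c' * (\<Prod>j\<in>I. l j))"
      using insert.hyps by (simp add: c algebra_simps)
    ultimately show "\<exists>d c'. \<not> l j dvd d \<and> b * d = c' * (\<Prod>j\<in>I. l j)"
      using l0 by auto
  qed (use insert.prems in auto)
  then show ?case using insert.hyps by (simp add: c)
qed simp

text \<open>
  The group is given by the functions \<open>Q\<close> through which it acts, with unit \<open>e\<close>. These functions are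
  only specified on the carrier \<open>R\<close>, so closure under composition and inverses is expressed by the
  condition that left translation by an element of \<open>Q\<close> agrees on \<open>R\<close> with a permutation of \<open>Q\<close>.
\<close>
locale finite_ring_action =
  fixes R :: "'a::idom set" and Q :: "('a \<Rightarrow> 'a) set" and e :: "'a \<Rightarrow> 'a"
  assumes one: "1 \<in> R"
    and diff: "\<And>f g. f \<in> R \<Longrightarrow> g \<in> R \<Longrightarrow> f - g \<in> R"
    and mult: "\<And>f g. f \<in> R \<Longrightarrow> g \<in> R \<Longrightarrow> f * g \<in> R"
    and saturated: "\<And>d f. d \<in> R \<Longrightarrow> d \<noteq> 0 \<Longrightarrow> d * f \<in> R \<Longrightarrow> f \<in> R"
    and fin: "finite Q"
    and e: "e \<in> Q" "\<And>f. f \<in> R \<Longrightarrow> e f = f"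
    and act: "\<And>q f. q \<in> Q \<Longrightarrow> f \<in> R \<Longrightarrow> q f \<in> R"
    and act_diff: "\<And>q f g. q \<in> Q \<Longrightarrow> f \<in> R \<Longrightarrow> g \<in> R \<Longrightarrow> q (f - g) = q f - q g"
    and act_mult: "\<And>q f g. q \<in> Q \<Longrightarrow> f \<in> R \<Longrightarrow> g \<in> R \<Longrightarrow> q (f * g) = q f * q g"
    and act_one: "\<And>q. q \<in> Q \<Longrightarrow> q 1 = 1"
    and translation: "\<And>q. q \<in> Q \<Longrightarrow> \<exists>\<pi>. bij_betw \<pi> Q Q \<and> (\<forall>q'\<in>Q. \<forall>f\<in>R. q (q' f) = \<pi> q' f)"
begin

definition fixed :: "'a set" where "fixed = {f \<in> R. \<forall>q\<in>Q. q f = f}"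

definition trace :: "'a \<Rightarrow> 'a" where "trace f = (\<Sum>q\<in>Q. q f)"

definition norm :: "'a \<Rightarrow> 'a" where "norm f = (\<Prod>q\<in>Q. q f)"

lemma zero: "0 \<in> R"
  using diff[OF one one] by simp

lemma add: "f \<in> R \<Longrightarrow> g \<in> R \<Longrightarrow> f + g \<in> R"
  using diff[of f "0 - g"] diff[OF zero, of g] by simp

lemma act_zero: "q \<in> Q \<Longrightarrow> q 0 = 0"
  using act_diff[of q 1 1] one by simp

lemma act_add: "q \<in> Q \<Longrightarrow> f \<in> R \<Longrightarrow> g \<in> R \<Longrightarrow> q (f + g) = q f + q g"
  using act_diff[of q "f + g" g] add by simp

lemma sum_closed: "(\<And>i. i \<in> I \<Longrightarrow> h i \<in> R) \<Longrightarrow> (\<Sum>i\<in>I. h i) \<in> R"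
  by (induction I rule: infinite_finite_induct) (auto simp: zero add)

lemma prod_closed: "(\<And>i. i \<in> I \<Longrightarrow> h i \<in> R) \<Longrightarrow> (\<Prod>i\<in>I. h i) \<in> R"
  by (induction I rule: infinite_finite_induct) (auto simp: one mult)

lemma act_sum: "q \<in> Q \<Longrightarrow> (\<And>i. i \<in> I \<Longrightarrow> h i \<in> R) \<Longrightarrow> q (\<Sum>i\<in>I. h i) = (\<Sum>i\<in>I. q (h i))"
  by (induction I rule: infinite_finite_induct) (simp_all add: act_zero act_add sum_closed)

lemma act_prod: "q \<in> Q \<Longrightarrow> (\<And>i. i \<in> I \<Longrightarrow> h i \<in> R) \<Longrightarrow> q (\<Prod>i\<in>I. h i) = (\<Prod>i\<in>I. q (h i))"
  by (induction I rule: infinite_finite_induct) (simp_all add: act_one act_mult prod_closed)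

lemma trace_fixed:
  assumes "f \<in> R" shows "trace f \<in> fixed"
proof -
  have "q (trace f) = trace f" if q: "q \<in> Q" for q
  proof -
    obtain \<pi> where \<pi>: "bij_betw \<pi> Q Q" "\<forall>q'\<in>Q. q (q' f) = \<pi> q' f"
      using translation[OF q] assms by blast
    have "q (trace f) = (\<Sum>q'\<in>Q. \<pi> q' f)"
      unfolding trace_def using \<pi>(2) q assms by (simp add: act_sum act)
    also have "\<dots> = trace f" unfolding trace_def by (rule sum.reindex_bij_betw[OF \<pi>(1)])
    finally show ?thesis .
  qed
  then show ?thesis using assms by (auto simp: fixed_def trace_def intro: sum_closed act)
qed

lemma norm_fixed:
  assumes "f \<in> R" shows "norm f \<in> fixed"
proof -
  have "q (norm f) = norm f" if q: "q \<in> Q" for q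
  proof -
    obtain \<pi> where \<pi>: "bij_betw \<pi> Q Q" "\<forall>q'\<in>Q. q (q' f) = \<pi> q' f"
      using translation[OF q] assms by blast
    have "q (norm f) = (\<Prod>q'\<in>Q. \<pi> q' f)"
      unfolding norm_def using \<pi>(2) q assms by (simp add: act_prod act)
    also have "\<dots> = norm f" unfolding norm_def by (rule prod.reindex_bij_betw[OF \<pi>(1)])
    finally show ?thesis .
  qed
  then show ?thesis using assms by (auto simp: fixed_def norm_def intro: prod_closed act)
qed

text \<open>Right inverses for all elements of a monoid make it a group; \<open>act_nonzero\<close> uses this twice.\<close>
lemma act_right_inverse:
  assumes "q \<in> Q" shows "\<exists>q'\<in>Q. \<forall>f\<in>R. q (q' f) = f"
proof -
  obtain \<pi> where \<pi>: "bij_betw \<pi> Q Q" "\<forall>q'\<in>Q. \<forall>f\<in>R. q (q' f) = \<pi> q' f"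
    using translation[OF assms] by blast
  obtain q' where "q' \<in> Q" "\<pi> q' = e" using \<pi>(1) e(1) by (metis bij_betw_iff_bijections)
  then show ?thesis using \<pi>(2) e(2) by auto
qed

lemma act_nonzero:
  assumes "q \<in> Q" "f \<in> R" "f \<noteq> 0" shows "q f \<noteq> 0"
proof
  assume 0: "q f = 0"
  obtain q' where q': "q' \<in> Q" "\<forall>f\<in>R. q (q' f) = f" using act_right_inverse[OF assms(1)] by blast
  obtain q'' where q'': "q'' \<in> Q" "\<forall>f\<in>R. q' (q'' f) = f" using act_right_inverse[OF q'(1)] by blast
  have "q (q' (q'' f)) = q'' f" using q'(2) act[OF q''(1) assms(2)] by blast
  then have "q'' f = 0" using q''(2) assms(2) 0 by simp
  then have "f = 0" using q'' q'(1) assms(2) act_zero by metis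
  then show False using assms(3) by simp
qed

lemma trace_mult_fixed: "r \<in> fixed \<Longrightarrow> f \<in> R \<Longrightarrow> trace (r * f) = r * trace f"
  by (auto simp: trace_def sum_distrib_left fixed_def act_mult intro!: sum.cong)

text \<open>Classically, for \<open>R\<close> generated over the fixed ring by a single element \<open>v\<close>, taking \<open>v\<close> for every \<open>v q\<close> gives,
  up to sign, the value at \<open>v\<close> of the derivative of its characteristic polynomial, that is, a
  generator of the different.\<close>
definition different :: "(('a \<Rightarrow> 'a) \<Rightarrow> 'a) \<Rightarrow> 'a" where
  "different v = (\<Prod>q\<in>Q - {e}. q (v q) - v q)"

text \<open>A tensor \<open>u \<otimes> w\<close> of elements of \<open>R\<close> gives the function \<open>\<tau> \<mapsto> u * \<tau> w\<close> on \<open>Q\<close>, and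
  \<open>\<Prod> (q (v q) \<otimes> 1 - 1 \<otimes> v q)\<close> over \<open>q \<noteq> e\<close> gives \<open>different v\<close> at \<open>e\<close> and zero elsewhere, because at
  \<open>\<tau> \<noteq> e\<close> the factor with \<open>q = \<tau>\<close> vanishes. So a property of functions on \<open>Q\<close> that holds for pure
  tensors and is closed under subtraction holds for this one.\<close>
lemma tensor_induct:
  assumes v: "\<And>q. q \<in> Q \<Longrightarrow> v q \<in> R"
    and P_tensor: "\<And>u w. u \<in> R \<Longrightarrow> w \<in> R \<Longrightarrow> P (\<lambda>\<tau>. u * \<tau> w)"
    and P_diff: "\<And>s t. P s \<Longrightarrow> P t \<Longrightarrow> P (\<lambda>\<tau>. s \<tau> - t \<tau>)"
    and P_cong: "\<And>s t. P s \<Longrightarrow> (\<And>\<tau>. \<tau> \<in> Q \<Longrightarrow> s \<tau> = t \<tau>) \<Longrightarrow> P t"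
  shows "P (\<lambda>\<tau>. if \<tau> = e then different v else 0)"
proof -
  have step: "P (\<lambda>\<tau>. u * \<tau> w * (\<Prod>q\<in>A. q (v q) - \<tau> (v q)))"
    if "finite A" "A \<subseteq> Q" "u \<in> R" "w \<in> R" for A u w
    using that
  proof (induction A arbitrary: u w rule: finite_induct)
    case empty
    then show ?case using P_tensor by simp
  next
    case (insert q A)
    have R: "v q \<in> R" "q (v q) \<in> R" using insert.prems v act by auto
    show ?case
      by (rule P_cong[OF P_diff[OF insert.IH[of "u * q (v q)" w] insert.IH[of u "w * v q"]]])
        (use insert R in \<open>auto simp: act_mult mult algebra_simps\<close>)
  qed
  have "P (\<lambda>\<tau>. 1 * \<tau> 1 * (\<Prod>q\<in>Q - {e}. q (v q) - \<tau> (v q)))"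
    by (rule step) (auto simp: fin one)
  then show ?thesis
  proof (rule P_cong)
    fix \<tau> assume \<tau>: "\<tau> \<in> Q"
    show "1 * \<tau> 1 * (\<Prod>q\<in>Q - {e}. q (v q) - \<tau> (v q)) = (if \<tau> = e then different v else 0)"
    proof (cases "\<tau> = e")
      case True
      have "(\<Prod>q\<in>Q - {e}. q (v q) - e (v q)) = different v"
        unfolding different_def using e(2) v by (intro prod.cong) auto
      then show ?thesis using True e(1) by (simp add: act_one)
    next
      case False
      then have "(\<Prod>q\<in>Q - {e}. q (v q) - \<tau> (v q)) = 0"
        using \<tau> fin by (intro prod_zero) auto
      then show ?thesis using False by simp
    qed
  qed
qed

lemma sum_different: "f \<in> R \<Longrightarrow> (\<Sum>\<tau>\<in>Q. (if \<tau> = e then d else 0) * \<tau> f) = d * f"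
proof -
  assume "f \<in> R"
  have "(\<Sum>\<tau>\<in>Q. (if \<tau> = e then d else 0) * \<tau> f) = (\<Sum>\<tau>\<in>Q. if \<tau> = e then d * \<tau> f else 0)"
    by (intro sum.cong) auto
  then show ?thesis using fin e \<open>f \<in> R\<close> by simp
qed

text \<open>The hypothesis says that pairing the function of a pure tensor with \<open>\<tau> \<mapsto> \<tau> c\<close> gives zero; pairing
  the function that is supported at \<open>e\<close> gives \<open>different v * c\<close>.\<close>
lemma trace_nondegenerate:
  assumes v: "\<And>q. q \<in> Q \<Longrightarrow> v q \<in> R" and d: "different v \<noteq> 0"
    and c: "c \<in> R" and z: "\<And>f. f \<in> R \<Longrightarrow> trace (c * f) = 0"
  shows "c = 0"
proof -
  have "(\<Sum>\<tau>\<in>Q. (if \<tau> = e then different v else 0) * \<tau> c) = 0"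
  proof (rule tensor_induct[OF v, where P = "\<lambda>t. (\<Sum>\<tau>\<in>Q. t \<tau> * \<tau> c) = 0"])
    fix u w assume "u \<in> R" "w \<in> R"
    then show "(\<Sum>\<tau>\<in>Q. u * \<tau> w * \<tau> c) = 0"
      using z[of w] c by (simp add: trace_def act_mult sum_distrib_left[symmetric] mult_ac)
  qed (auto simp: left_diff_distrib sum_subtractf)
  then show ?thesis using d c by (simp add: sum_different)
qed

text \<open>If a function on \<open>Q\<close> comes from the tensor \<open>u \<otimes> w\<close>, then its pairing with \<open>\<tau> \<mapsto> \<tau> f\<close> is
  \<open>u * trace (w * f)\<close>, and linearity of \<open>\<rho>\<close> turns this into \<open>trace (\<rho> u * w * f)\<close>. For the function
  supported at \<open>e\<close> the pairing is \<open>different v * f\<close>.\<close>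
lemma splitting_as_trace:
  assumes v: "\<And>q. q \<in> Q \<Longrightarrow> v q \<in> R"
    and \<rho>: "\<And>f. f \<in> R \<Longrightarrow> \<rho> f \<in> fixed"
      "\<And>f g. f \<in> R \<Longrightarrow> g \<in> R \<Longrightarrow> \<rho> (f + g) = \<rho> f + \<rho> g"
      "\<And>r f. r \<in> fixed \<Longrightarrow> f \<in> R \<Longrightarrow> \<rho> (r * f) = r * \<rho> f"
  shows "\<exists>c\<in>R. \<forall>f\<in>R. \<rho> (different v * f) = trace (c * f)"
proof -
  have \<rho>_diff: "\<rho> (f - g) = \<rho> f - \<rho> g" if "f \<in> R" "g \<in> R" for f g
    using \<rho>(2)[of "f - g" g] that diff by simp
  define P where "P t \<longleftrightarrow> (\<forall>\<tau>\<in>Q. t \<tau> \<in> R) \<and> (\<exists>c\<in>R. \<forall>f\<in>R. \<rho> (\<Sum>\<tau>\<in>Q. t \<tau> * \<tau> f) = trace (c * f))" for t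
  have "P (\<lambda>\<tau>. if \<tau> = e then different v else 0)"
  proof (rule tensor_induct[OF v])
    fix u w assume uw: "u \<in> R" "w \<in> R"
    have "\<rho> (\<Sum>\<tau>\<in>Q. u * \<tau> w * \<tau> f) = trace (\<rho> u * w * f)" if f: "f \<in> R" for f
    proof -
      have u: "\<rho> u \<in> fixed" "\<rho> u \<in> R" using \<rho>(1)[of u] uw by (auto simp: fixed_def)
      have "(\<Sum>\<tau>\<in>Q. u * \<tau> w * \<tau> f) = trace (w * f) * u"
        using uw f by (simp add: trace_def act_mult sum_distrib_left mult_ac)
      also have "\<rho> \<dots> = trace (w * f) * \<rho> u"
        using uw f by (intro \<rho>(3) trace_fixed mult)
      also have "\<dots> = trace (\<rho> u * w * f)"
        using trace_mult_fixed[OF u(1), of "w * f"] uw f by (simp add: mult mult_ac)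
      finally show ?thesis .
    qed
    moreover have "\<rho> u * w \<in> R" using \<rho>(1)[of u] uw by (auto simp: fixed_def mult)
    ultimately show "P (\<lambda>\<tau>. u * \<tau> w)" unfolding P_def using uw by (auto simp: mult act)
  next
    fix s t assume "P s" "P t"
    then obtain c c' where s: "\<forall>\<tau>\<in>Q. s \<tau> \<in> R" "c \<in> R" "\<forall>f\<in>R. \<rho> (\<Sum>\<tau>\<in>Q. s \<tau> * \<tau> f) = trace (c * f)"
      and t: "\<forall>\<tau>\<in>Q. t \<tau> \<in> R" "c' \<in> R" "\<forall>f\<in>R. \<rho> (\<Sum>\<tau>\<in>Q. t \<tau> * \<tau> f) = trace (c' * f)"
      unfolding P_def by blast
    have "\<rho> (\<Sum>\<tau>\<in>Q. (s \<tau> - t \<tau>) * \<tau> f) = trace ((c - c') * f)" if f: "f \<in> R" for f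
    proof -
      have "\<rho> (\<Sum>\<tau>\<in>Q. (s \<tau> - t \<tau>) * \<tau> f) = \<rho> (\<Sum>\<tau>\<in>Q. s \<tau> * \<tau> f) - \<rho> (\<Sum>\<tau>\<in>Q. t \<tau> * \<tau> f)"
        unfolding left_diff_distrib sum_subtractf
      proof (rule \<rho>_diff)
        show "(\<Sum>\<tau>\<in>Q. s \<tau> * \<tau> f) \<in> R"
          by (rule sum_closed, rule mult) (use s(1) act f in blast)+
        show "(\<Sum>\<tau>\<in>Q. t \<tau> * \<tau> f) \<in> R"
          by (rule sum_closed, rule mult) (use t(1) act f in blast)+
      qed
      then show ?thesis using s t f
        by (simp add: trace_def left_diff_distrib act_diff mult sum_subtractf)
    qed
    then show "P (\<lambda>\<tau>. s \<tau> - t \<tau>)" unfolding P_def using s t diff by blast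
  next
    fix s t assume "P s" "\<And>\<tau>. \<tau> \<in> Q \<Longrightarrow> s \<tau> = t \<tau>"
    moreover from this have "(\<Sum>\<tau>\<in>Q. s \<tau> * \<tau> f) = (\<Sum>\<tau>\<in>Q. t \<tau> * \<tau> f)" for f by (intro sum.cong) auto
    ultimately show "P t" unfolding P_def by simp
  qed
  then show ?thesis unfolding P_def by (simp add: sum_different)
qed

text \<open>
  The element \<open>a\<close> is \<open>c / different v\<close> with \<open>c\<close> as in \<open>splitting_as_trace\<close>. By nondegeneracy of the
  trace, another family \<open>w\<close> leads to the same fraction, and \<open>avoid\<close> supplies a family whose
  denominator is prime to any given factor of \<open>different v\<close>.
\<close>
theorem splitting_imp_trace_one:
  assumes \<rho>: "\<And>f. f \<in> R \<Longrightarrow> \<rho> f \<in> fixed"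
      "\<And>f g. f \<in> R \<Longrightarrow> g \<in> R \<Longrightarrow> \<rho> (f + g) = \<rho> f + \<rho> g"
      "\<And>r f. r \<in> fixed \<Longrightarrow> f \<in> R \<Longrightarrow> \<rho> (r * f) = r * \<rho> f"
      "\<And>r. r \<in> fixed \<Longrightarrow> \<rho> r = r"
    and v: "\<And>q. q \<in> Q \<Longrightarrow> v q \<in> R"
    and pr: "\<And>q. q \<in> Q - {e} \<Longrightarrow> prime_elem (q (v q) - v q)"
    and avoid: "\<And>q q'. q \<in> Q - {e} \<Longrightarrow> q' \<in> Q - {e} \<Longrightarrow>
      \<exists>w\<in>R. \<not> (q (v q) - v q) dvd q' w - w"
  shows "\<exists>a\<in>R. trace a = 1"
proof -
  let ?d = "different v"
  have Rd: "different w \<in> R" if "\<And>q. q \<in> Q \<Longrightarrow> w q \<in> R" for w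
    unfolding different_def by (rule prod_closed, rule diff) (use that act in blast)+
  have dR: "?d \<in> R" using Rd[of v] v by blast
  have "q (v q) - v q \<noteq> 0" if "q \<in> Q - {e}" for q
    using pr[OF that] by (auto simp: prime_elem_def)
  then have d0: "?d \<noteq> 0" unfolding different_def using fin by auto
  have represent: "\<exists>c\<in>R. \<forall>f\<in>R. \<rho> (different w * f) = trace (c * f)" if "\<And>q. q \<in> Q \<Longrightarrow> w q \<in> R" for w
    by (rule splitting_as_trace) (use that \<rho> in blast)+
  obtain c where c: "c \<in> R" "\<And>f. f \<in> R \<Longrightarrow> \<rho> (?d * f) = trace (c * f)"
    using represent[of v] v by blast
  have "?d dvd c"
    unfolding different_def
  proof (rule prime_prod_dvd)
    fix q assume q: "q \<in> Q - {e}"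
    define w where "w q' = (if q' = e then 0 else SOME w. w \<in> R \<and> \<not> (q (v q) - v q) dvd q' w - w)" for q'
    have w: "w q' \<in> R \<and> \<not> (q (v q) - v q) dvd q' (w q') - w q'" if "q' \<in> Q - {e}" for q'
      using someI_ex[OF avoid[OF q that, unfolded Bex_def]] that by (simp add: w_def)
    have wR: "w q' \<in> R" if "q' \<in> Q" for q' using w[of q'] that zero by (auto simp: w_def)
    have dwR: "different w \<in> R" using Rd[of w] wR by blast
    obtain c' where c': "c' \<in> R" "\<And>f. f \<in> R \<Longrightarrow> \<rho> (different w * f) = trace (c' * f)"
      using represent[of w] wR by blast
    have "\<not> (q (v q) - v q) dvd different w"
    proof
      assume "(q (v q) - v q) dvd different w"
      then obtain q' where "q' \<in> Q - {e}" "(q (v q) - v q) dvd q' (w q') - w q'"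
        unfolding different_def using fin by (elim prime_elem_dvd_prodE[OF pr[OF q], rotated]) auto
      then show False using w by blast
    qed
    moreover have "c * different w - c' * ?d = 0"
    proof (rule trace_nondegenerate[OF v d0])
      show "c * different w - c' * ?d \<in> R" using c c' dR dwR by (intro diff mult)
      fix f assume f: "f \<in> R"
      \<comment> \<open>Both \<open>c * different w\<close> and \<open>c' * ?d\<close> represent \<open>f \<mapsto> \<rho> (?d * different w * f)\<close>.\<close>
      have "trace (c * (different w * f)) = \<rho> (?d * (different w * f))"
        using c(2)[of "different w * f"] f dwR mult by simp
      also have "?d * (different w * f) = different w * (?d * f)" by (simp add: mult_ac)
      also have "\<rho> \<dots> = trace (c' * (?d * f))"
        using c'(2)[of "?d * f"] f dR mult by simp
      finally show "trace ((c * different w - c' * ?d) * f) = 0"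
        using c c' f dR dwR
        by (simp add: trace_def left_diff_distrib act_diff mult sum_subtractf mult.assoc)
    qed
    ultimately show "\<exists>d c'. \<not> (q (v q) - v q) dvd d \<and> c * d = c' * (\<Prod>q\<in>Q - {e}. q (v q) - v q)"
      unfolding different_def[symmetric] by auto
  qed (use fin pr in auto)
  then obtain a where a: "c = ?d * a" by blast
  have aR: "a \<in> R" using saturated[of ?d a] dR d0 c(1) a by simp
  \<comment> \<open>This cofactor makes \<open>?d * ?f\<close> a norm, hence a fixed element, on which \<open>\<rho>\<close> is known.\<close>
  let ?f = "\<Prod>q\<in>Q - {e}. q ?d"
  have fR: "?f \<in> R" by (rule prod_closed) (use dR act in blast)
  have N: "norm ?d = ?d * ?f"
    unfolding norm_def using prod.remove[OF fin e(1), of "\<lambda>q. q ?d"] e(2)[OF dR] by simp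
  have "norm ?d = \<rho> (?d * ?f)" using \<rho>(4)[OF norm_fixed[OF dR]] N by simp
  also have "\<dots> = trace (norm ?d * a)" using c(2)[OF fR] by (simp add: a N mult_ac)
  also have "\<dots> = norm ?d * trace a" using trace_mult_fixed norm_fixed dR aR by simp
  finally have "norm ?d * (trace a - 1) = 0" by (simp add: algebra_simps)
  moreover have "norm ?d \<noteq> 0"
    unfolding norm_def using fin act_nonzero[OF _ dR d0] by auto
  ultimately show ?thesis using aR by auto
qed

end

section \<open>Invariants of disjoint transpositions\<close>

lemma polys_closed:
  "Const c \<in> polys n" "i \<in> {1..n} \<Longrightarrow> Var i \<in> polys n"
  "f \<in> polys n \<Longrightarrow> g \<in> polys n \<Longrightarrow> f + g \<in> polys n"
  "f \<in> polys n \<Longrightarrow> g \<in> polys n \<Longrightarrow> f - g \<in> polys n"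
  "f \<in> polys n \<Longrightarrow> g \<in> polys n \<Longrightarrow> f * g \<in> polys n"
  by (simp_all add: polys_iff subst_hom restrict_vars_def)

lemma subst_polys:
  assumes "f \<in> polys n" "\<And>i. i \<in> {1..n} \<Longrightarrow> y i \<in> polys n"
  shows "subst y f \<in> polys n"
proof -
  have "subst (restrict_vars n) (subst y f) = subst (\<lambda>i. subst (restrict_vars n) (y i)) f"
    by (rule subst_subst)
  also have "\<dots> = subst y f"
    using assms(2) by (intro polys_subst[OF assms(1)]) (simp add: polys_iff)
  finally show ?thesis by (simp add: polys_iff)
qed

lemma perm_act_hom:
  "perm_act \<sigma> 0 = 0" "perm_act \<sigma> 1 = 1" "perm_act \<sigma> (f + g) = perm_act \<sigma> f + perm_act \<sigma> g"
  "perm_act \<sigma> (- f) = - perm_act \<sigma> f" "perm_act \<sigma> (f - g) = perm_act \<sigma> f - perm_act \<sigma> g"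
  "perm_act \<sigma> (f * g) = perm_act \<sigma> f * perm_act \<sigma> g"
  "perm_act \<sigma> (\<Sum>i\<in>I. h i) = (\<Sum>i\<in>I. perm_act \<sigma> (h i))"
  "perm_act \<sigma> (\<Prod>i\<in>I. h i) = (\<Prod>i\<in>I. perm_act \<sigma> (h i))"
  "perm_act \<sigma> (Const c) = Const c"
  by (simp_all add: perm_act_def subst_hom)

lemma perm_act_compose: "perm_act \<sigma> (perm_act \<tau> f) = perm_act (\<sigma> \<circ> \<tau>) f"
  by (simp add: perm_act_def subst_subst subst_Var)

lemma perm_act_id: "perm_act id f = f"
  by (simp add: perm_act_def subst_Var_id)

definition sum_prod_vars :: "nat \<Rightarrow> nat \<Rightarrow> nat \<Rightarrow> 'k::comm_ring_1 mpoly" where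
  "sum_prod_vars a b = Var(a := Var a + Var b, b := Var a * Var b)"

lemma sum_prod_vars_Var:
  assumes "a \<noteq> b"
  shows "sum_prod_vars a b a = Var a + Var b" "sum_prod_vars a b b = Var a * Var b"
    "i \<noteq> a \<Longrightarrow> i \<noteq> b \<Longrightarrow> sum_prod_vars a b i = Var i"
  using assms by (simp_all add: sum_prod_vars_def)

lemma Var_diff_nonzero:
  assumes "a \<noteq> b" shows "Var a - Var b \<noteq> (0 :: 'k::comm_ring_1 mpoly)"
proof
  assume 0: "Var a - Var b = (0 :: 'k mpoly)"
  have "subst (\<lambda>i. if i = a then 1 else 0) (Var a - Var b) = (1 :: 'k mpoly)"
    using assms by (simp add: subst_hom)
  then show False by (simp add: 0 subst_0)
qed

lemma Var_nonzero: "Var a \<noteq> (0 :: 'k::comm_ring_1 mpoly)"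
proof
  assume "Var a = (0 :: 'k mpoly)"
  moreover have "subst (\<lambda>i. 1) (Var a) = (1 :: 'k mpoly)" by (simp add: subst_Var)
  ultimately show False by (simp add: subst_0)
qed

text \<open>Setting \<open>x\<^sub>b = 0\<close> in \<open>f (x\<^sub>a + x\<^sub>b, x\<^sub>a x\<^sub>b) = 0\<close> gives \<open>f (x\<^sub>a, 0) = 0\<close>, so \<open>x\<^sub>b\<close> divides \<open>f\<close>; the quotient
  is again in the kernel, so that arbitrarily high powers of \<open>x\<^sub>b\<close> divide \<open>f\<close>.\<close>
lemma sum_prod_inj:
  fixes f :: "'k::idom mpoly"
  assumes ab: "a \<noteq> b" and f: "subst (sum_prod_vars a b) f = 0"
  shows "f = 0"
proof -
  have "Var b ^ k dvd f" for k
  proof (induction k)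
    case (Suc k)
    then obtain g where g: "f = Var b ^ k * g" by blast
    then have "(Var a * Var b) ^ k * subst (sum_prod_vars a b) g = 0"
      using f ab by (simp add: subst_mult subst_power subst_Var sum_prod_vars_Var)
    then have "subst (sum_prod_vars a b) g = 0"
      by (simp add: Var_nonzero)
    then have "subst (Var(b := 0)) (subst (sum_prod_vars a b) g) = 0"
      by (simp add: subst_0)
    moreover have "(\<lambda>i. subst (Var(b := 0)) (sum_prod_vars a b i)) = (Var(b := 0) :: nat \<Rightarrow> 'k mpoly)"
      using ab by (auto simp: sum_prod_vars_def subst_hom)
    ultimately have "subst (Var(b := 0)) g = 0" by (simp add: subst_subst)
    moreover have "Var b dvd subst Var g - subst (Var(b := 0)) g"
      by (rule dvd_subst_diff) simp
    ultimately have "Var b dvd g" by (simp add: subst_Var_id)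
    then show ?case by (simp add: g mult_dvd_mono mult.commute)
  qed simp
  then have "Poly_Mapping.keys f = {}"
    using Var_power_dvd_imp[of b _ f] by (metis Suc_n_not_le_n equals0I)
  then show ?thesis by simp
qed

text \<open>The elements of this form are a ring, because \<open>x\<^sub>a\<close> is a root of the quadratic
  polynomial \<open>X^2 - (x\<^sub>a + x\<^sub>b) X + x\<^sub>a x\<^sub>b\<close>, and they contain all variables.\<close>
lemma sum_prod_decomposition:
  fixes f :: "'k::idom mpoly"
  assumes ab: "a \<noteq> b" "a \<in> {1..n}" "b \<in> {1..n}" and f: "f \<in> polys n"
  shows "\<exists>g\<in>polys n. \<exists>h\<in>polys n.
    f = subst (sum_prod_vars a b) g + subst (sum_prod_vars a b) h * Var a"
proof -
  let ?\<phi> = "subst (sum_prod_vars a b)"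
  let ?A = "{?\<phi> g + ?\<phi> h * Var a |g h. g \<in> polys n \<and> h \<in> polys n}"
  have 0: "0 \<in> polys n" and 1: "1 \<in> polys n" using polys_closed(1)[of 0 n] polys_closed(1)[of 1 n] by (simp_all add: Const_hom)
  have "f \<in> ?A"
  proof (rule subring_contains_polys[OF f])
    fix c :: 'k
    show "Const c \<in> ?A"
      by (rule CollectI, intro exI[of _ "Const c"] exI[of _ 0]) (simp add: subst_hom polys_closed 0)
  next
    fix i assume i: "i \<in> {1..n}"
    consider "i = a" | "i = b" | "i \<noteq> a" "i \<noteq> b" by blast
    then show "Var i \<in> ?A"
    proof cases
      case 1
      then show ?thesis
        by (intro CollectI exI[of _ 0] exI[of _ 1]) (use 0 \<open>1 \<in> polys n\<close> in \<open>simp add: subst_hom\<close>)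
    next
      case 2
      then show ?thesis
        by (intro CollectI exI[of _ "Var a"] exI[of _ "- 1"])
          (use ab polys_closed(4)[OF 0 \<open>1 \<in> polys n\<close>] in \<open>simp add: subst_hom sum_prod_vars_Var polys_closed\<close>)
    next
      case 3
      then show ?thesis using i ab
        by (intro CollectI exI[of _ "Var i"] exI[of _ 0]) (simp add: subst_hom sum_prod_vars_Var polys_closed 0)
    qed
  next
    fix x y :: "'k mpoly" assume "x \<in> ?A" "y \<in> ?A"
    then obtain g h g' h' where x: "x = ?\<phi> g + ?\<phi> h * Var a" "g \<in> polys n" "h \<in> polys n"
      and y: "y = ?\<phi> g' + ?\<phi> h' * Var a" "g' \<in> polys n" "h' \<in> polys n" by blast
    show "x + y \<in> ?A"
      by (rule CollectI, intro exI[of _ "g + g'"] exI[of _ "h + h'"])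
        (use x y in \<open>simp add: subst_hom polys_closed algebra_simps\<close>)
    show "x * y \<in> ?A"
      by (rule CollectI, intro exI[of _ "g * g' - h * h' * Var b"] exI[of _ "g * h' + h * g' + h * h' * Var a"])
        (use x y ab in \<open>simp add: subst_hom sum_prod_vars_Var polys_closed algebra_simps\<close>)
  qed
  then show ?thesis by blast
qed

lemma sum_prod_symmetric:
  fixes f :: "'k::comm_ring_1 mpoly"
  assumes "a \<noteq> b"
  shows "perm_act (transpose a b) (subst (sum_prod_vars a b) f) = subst (sum_prod_vars a b) f"
proof -
  have "subst (\<lambda>i. Var (transpose a b i)) (sum_prod_vars a b i) = (sum_prod_vars a b i :: 'k mpoly)" for i
    using assms by (cases "i = a \<or> i = b") (auto simp: sum_prod_vars_def subst_hom add.commute mult.commute transpose_def)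
  then show ?thesis by (simp add: perm_act_def subst_subst)
qed

text \<open>In \<open>f = g' + h' * x\<^sub>a\<close> with symmetric \<open>g'\<close> and \<open>h'\<close>, the transposition changes \<open>f\<close> by
  \<open>h' * (x\<^sub>b - x\<^sub>a)\<close>, so that \<open>h' = 0\<close> for symmetric \<open>f\<close>.\<close>
lemma sum_prod_image:
  fixes f :: "'k::idom mpoly"
  assumes ab: "a \<noteq> b" "a \<in> {1..n}" "b \<in> {1..n}"
    and f: "f \<in> polys n" "perm_act (transpose a b) f = f"
  shows "\<exists>g\<in>polys n. f = subst (sum_prod_vars a b) g"
proof -
  let ?\<phi> = "subst (sum_prod_vars a b)"
  obtain g h where gh: "g \<in> polys n" "h \<in> polys n" "f = ?\<phi> g + ?\<phi> h * Var a"
    using sum_prod_decomposition[OF ab f(1)] by blast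
  have "?\<phi> g + ?\<phi> h * Var b = ?\<phi> g + ?\<phi> h * Var a"
    using f(2) unfolding gh(3) by (simp add: perm_act_hom perm_act_Var sum_prod_symmetric ab)
  then have "?\<phi> h * (Var a - Var b) = 0" by (simp only: right_diff_distrib add_left_cancel right_minus_eq)
  then have "?\<phi> h = 0" using Var_diff_nonzero[OF ab(1), where 'k = 'k] by simp
  then show ?thesis using gh by auto
qed

text \<open>The substitution for one transposition commutes with all the others of the family. So it maps
  the invariants of the remaining transpositions onto the invariants of the whole family.\<close>
lemma invariants_disjoint_transpositions:
  assumes "finite P"
    and "\<And>a b. (a, b) \<in> P \<Longrightarrow> a \<noteq> b \<and> a \<in> {1..n} \<and> b \<in> {1..n}"
    and "\<And>a b c d. (a, b) \<in> P \<Longrightarrow> (c, d) \<in> P \<Longrightarrow> (a, b) \<noteq> (c, d) \<Longrightarrow> {a, b} \<inter> {c, d} = {}"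
  shows "\<exists>\<phi>. k_algebra_iso \<phi> (polys n)
    {f \<in> polys n. \<forall>(a, b)\<in>P. perm_act (transpose a b) f = (f :: 'k::idom mpoly)}"
  using assms
proof (induction P rule: finite_induct)
  case empty
  have "k_algebra_iso (\<lambda>f. f) (polys n) (polys n :: 'k mpoly set)"
    by (simp add: k_algebra_iso_def bij_betw_def)
  then show ?case by auto
next
  case (insert ab P)
  obtain a b where ab: "ab = (a, b)" by (cases ab)
  have abn: "a \<noteq> b" "a \<in> {1..n}" "b \<in> {1..n}" using insert.prems(1)[of a b] ab by auto
  let ?I = "{f \<in> polys n. \<forall>(a, b)\<in>P. perm_act (transpose a b) f = (f :: 'k mpoly)}"
  let ?J = "{f \<in> polys n. \<forall>(a, b)\<in>insert ab P. perm_act (transpose a b) f = (f :: 'k mpoly)}"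
  obtain \<phi> where \<phi>: "k_algebra_iso \<phi> (polys n) ?I"
    using insert.IH insert.prems by (metis (no_types, lifting) insertCI)
  let ?\<psi> = "subst (sum_prod_vars a b) :: 'k mpoly \<Rightarrow> 'k mpoly"
  have comm: "perm_act (transpose c d) (?\<psi> f) = ?\<psi> (perm_act (transpose c d) f)" if cd: "(c, d) \<in> P" for c d f
  proof -
    have disj: "{a, b} \<inter> {c, d} = {}" using insert.prems(2)[of a b c d] cd insert.hyps ab by auto
    then have "transpose c d a = a" "transpose c d b = b"
      "i \<noteq> a \<Longrightarrow> i \<noteq> b \<Longrightarrow> transpose c d i \<noteq> a \<and> transpose c d i \<noteq> b" for i
      by (auto simp: transpose_def)
    then have "subst (\<lambda>i. Var (transpose c d i)) (sum_prod_vars a b i)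
        = (subst (sum_prod_vars a b) (Var (transpose c d i)) :: 'k mpoly)" for i
      using abn by (cases "i = a \<or> i = b") (auto simp: subst_hom sum_prod_vars_Var)
    then show ?thesis by (simp add: perm_act_def subst_subst)
  qed
  have inj: "inj ?\<psi>"
  proof (rule injI)
    fix f g assume "?\<psi> f = ?\<psi> g"
    then have "?\<psi> (f - g) = 0" by (simp add: subst_diff)
    then show "f = g" using sum_prod_inj[OF abn(1)] by fastforce
  qed
  have "?\<psi> ` ?I = ?J"
  proof (intro equalityI subsetI)
    fix f assume "f \<in> ?\<psi> ` ?I"
    then obtain g where g: "f = ?\<psi> g" "g \<in> ?I" by blast
    have "f \<in> polys n" unfolding g(1) using g(2) abn
      by (intro subst_polys) (auto simp: sum_prod_vars_def polys_closed)
    then show "f \<in> ?J" using g comm by (auto simp: ab sum_prod_symmetric abn)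
  next
    fix f assume f: "f \<in> ?J"
    then obtain g where g: "g \<in> polys n" "f = ?\<psi> g" using sum_prod_image[OF abn, of f] ab by auto
    have "perm_act (transpose c d) g = g" if cd: "(c, d) \<in> P" for c d
    proof -
      have "perm_act (transpose c d) f = f" using f cd by auto
      then show ?thesis using comm[OF cd, of g] injD[OF inj] by (simp add: g(2))
    qed
    then show "f \<in> ?\<psi> ` ?I" using g by blast
  qed
  then have "bij_betw ?\<psi> ?I ?J" using inj by (simp add: bij_betw_def inj_on_def)
  then have "bij_betw (?\<psi> \<circ> \<phi>) (polys n) ?J"
    using \<phi> bij_betw_trans unfolding k_algebra_iso_def by blast
  then have "k_algebra_iso (?\<psi> \<circ> \<phi>) (polys n) ?J"
    using \<phi> unfolding k_algebra_iso_def by (simp add: subst_hom)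
  then show ?case by blast
qed

section \<open>The subgroup generated by transpositions\<close>

locale permutation_subgroup =
  fixes n :: nat and G :: "(nat \<Rightarrow> nat) set"
  assumes subgroup: "subgroup G (sym_group n)"
begin

lemma permutes: "\<sigma> \<in> G \<Longrightarrow> \<sigma> permutes {1..n}"
  using subgroup.subset[OF subgroup] by (auto simp: sym_group_def)

lemma id_in: "id \<in> G"
  using subgroup.one_closed[OF subgroup] by (simp add: sym_group_def)

lemma comp_in: "\<sigma> \<in> G \<Longrightarrow> \<tau> \<in> G \<Longrightarrow> \<sigma> \<circ> \<tau> \<in> G"
  using subgroup.m_closed[OF subgroup] by (simp add: sym_group_def)

lemma inv_in: 
  assumes "\<sigma> \<in> G" shows "inv' \<sigma> \<in> G"
proof -
  have s: "\<sigma> permutes {1..n}" using permutes assms .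
  have "m_inv (sym_group n) \<sigma> = inv' \<sigma>"
    by (intro group.inv_equality sym_group_is_group)
      (use permutes_inv[OF s] permutes_inv_o[OF s] s in \<open>simp_all add: sym_group_def\<close>)
  then show ?thesis using subgroup.m_inv_closed[OF subgroup assms] by simp
qed

lemma finite_G: "finite G"
  by (rule finite_subset[OF _ finite_permutations[of "{1..n}"]]) (use permutes in auto)

lemma power_card:
  assumes "\<sigma> \<in> G" shows "\<sigma> ^^ card G = id"
proof -
  let ?H = "(sym_group n)\<lparr>carrier := G\<rparr>"
  interpret H: group ?H using subgroup.subgroup_is_group[OF subgroup sym_group_is_group] .
  have "\<sigma> [^]\<^bsub>?H\<^esub> k = \<sigma> ^^ k" for k :: nat
    by (induction k) (simp_all add: sym_group_def funpow_Suc_right del: funpow.simps(2))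
  then show ?thesis using H.pow_order_eq_1[of \<sigma>] assms by (simp add: order_def sym_group_def)
qed

text \<open>The blocks are the orbits of the subgroup that the transpositions in \<open>G\<close> generate.\<close>
definition block :: "nat \<Rightarrow> nat set" where
  "block i = {j \<in> {1..n}. transpose i j \<in> G}"

lemma transpose_conj:
  assumes "\<sigma> \<in> G" shows "transpose (\<sigma> i) (\<sigma> j) \<in> G \<longleftrightarrow> transpose i j \<in> G"
proof -
  have b: "bij \<sigma>" using permutes[OF assms] permutes_bij by blast
  have 1: "transpose (\<sigma> i) (\<sigma> j) = \<sigma> \<circ> transpose i j \<circ> inv' \<sigma>"
    using b by (auto simp: fun_eq_iff transpose_def bij_is_inj bij_is_surj surj_f_inv_f inv_f_eq)
  have 2: "transpose i j = inv' \<sigma> \<circ> transpose (\<sigma> i) (\<sigma> j) \<circ> \<sigma>"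
    using b by (auto simp: fun_eq_iff transpose_def bij_is_inj inj_eq)
  show ?thesis
    using 1 2 comp_in inv_in assms by metis
qed

lemma self_in_block: "i \<in> {1..n} \<Longrightarrow> i \<in> block i"
  by (simp add: block_def id_in)

lemma finite_block: "finite (block i)"
  by (simp add: block_def)

lemma block_eq:
  assumes "j \<in> block i" shows "block j = block i"
proof -
  have t: "transpose i j \<in> G" using assms by (simp add: block_def)
  have "transpose j k \<in> G \<longleftrightarrow> transpose i k \<in> G" for k
  proof (cases "k = i \<or> k = j")
    case True
    then show ?thesis using t id_in by (auto simp: transpose_commute)
  next
    case False
    then show ?thesis using transpose_conj[OF t, of i k] by simp
  qed
  then show ?thesis by (simp add: block_def)
qed

lemma in_block_iff:
  assumes "j \<in> {1..n}" shows "j \<in> block i \<longleftrightarrow> block j = block i"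
  using block_eq[of j i] self_in_block[OF assms] by auto

lemma in_range:
  assumes "\<sigma> \<in> G" "i \<in> {1..n}" shows "\<sigma> i \<in> {1..n}"
  using permutes_in_image[OF permutes[OF assms(1)]] assms(2) by simp

lemma block_image:
  assumes "\<sigma> \<in> G" shows "block (\<sigma> i) = \<sigma> ` block i"
proof (intro equalityI subsetI)
  fix k assume k: "k \<in> block (\<sigma> i)"
  have s: "\<sigma> permutes {1..n}" using permutes assms .
  obtain j where j: "k = \<sigma> j" using s by (metis permutes_surj surjD)
  then have "j \<in> {1..n}" using k permutes_in_image[OF s] by (auto simp: block_def)
  then show "k \<in> \<sigma> ` block i" using k transpose_conj[OF assms] by (auto simp: block_def j)
next
  fix k assume "k \<in> \<sigma> ` block i"
  then show "k \<in> block (\<sigma> i)" using transpose_conj[OF assms] in_range[OF assms] by (auto simp: block_def)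
qed

lemma block_image_eq_iff:
  assumes "\<sigma> \<in> G" "i \<in> {1..n}" "j \<in> {1..n}"
  shows "block (\<sigma> i) = block (\<sigma> j) \<longleftrightarrow> block i = block j"
  using permutes_inj[OF permutes[OF assms(1)]] by (simp add: block_image[OF assms(1)] inj_image_eq_iff)

definition transposition_invariants :: "'k::comm_ring_1 mpoly set" where
  "transposition_invariants = {f \<in> polys n.
     \<forall>i\<in>{1..n}. \<forall>j\<in>{1..n}. transpose i j \<in> G \<longrightarrow> perm_act (transpose i j) f = f}"

text \<open>A permutation that preserves all blocks is a product of transpositions in \<open>G\<close>: if it moves \<open>i\<close>,
  then composing it with the transposition of \<open>i\<close> and \<open>\<tau> i\<close> fixes one letter more.\<close>
lemma blockwise_trivial:
  assumes "\<tau> permutes {1..n}" "\<And>i. i \<in> {1..n} \<Longrightarrow> \<tau> i \<in> block i"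
  shows "\<tau> \<in> G \<and> (\<forall>f\<in>transposition_invariants. perm_act \<tau> f = (f :: 'k::comm_ring_1 mpoly))"
  using assms
proof (induction "card {i. \<tau> i \<noteq> i}" arbitrary: \<tau> rule: less_induct)
  case less
  show ?case
  proof (cases "\<tau> = id")
    case True
    then show ?thesis using id_in perm_act_id by auto
  next
    case False
    then obtain i where i: "\<tau> i \<noteq> i" by (auto simp: fun_eq_iff)
    have i_in: "i \<in> {1..n}" using less.prems(1) i by (meson permutes_not_in)
    have \<tau>i_in: "\<tau> i \<in> {1..n}" using permutes_in_image[OF less.prems(1)] i_in by blast
    have t: "transpose i (\<tau> i) \<in> G" using less.prems(2)[OF i_in] by (simp add: block_def)
    have inj: "\<tau> j = \<tau> k \<longleftrightarrow> j = k" for j k using permutes_inj[OF less.prems(1)] by (simp add: inj_eq)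
    define \<tau>' where "\<tau>' = transpose i (\<tau> i) \<circ> \<tau>"
    have \<tau>: "\<tau> = transpose i (\<tau> i) \<circ> \<tau>'" by (simp add: \<tau>'_def fun_eq_iff)
    have p: "\<tau>' permutes {1..n}"
      unfolding \<tau>'_def by (rule permutes_compose[OF less.prems(1) permutes_swap_id]) (use i_in \<tau>i_in in auto)
    have b: "\<tau>' j \<in> block j" if j: "j \<in> {1..n}" for j
    proof (cases "\<tau> j = i")
      case True
      then have "block i = block j" using block_eq less.prems(2)[OF j] by simp
      then show ?thesis using True less.prems(2)[OF i_in] by (simp add: \<tau>'_def)
    next
      case False
      then show ?thesis
        using less.prems(2)[OF j] self_in_block[OF j] inj[of j i] by (cases "j = i") (auto simp: \<tau>'_def)
    qed
    have "{j. \<tau>' j \<noteq> j} \<subset> {j. \<tau> j \<noteq> j}"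
    proof (intro psubsetI)
      show "{j. \<tau>' j \<noteq> j} \<subseteq> {j. \<tau> j \<noteq> j}"
        using i inj by (auto simp: \<tau>'_def transpose_def split: if_splits)
      have "i \<notin> {j. \<tau>' j \<noteq> j}" "i \<in> {j. \<tau> j \<noteq> j}" using i by (simp_all add: \<tau>'_def)
      then show "{j. \<tau>' j \<noteq> j} \<noteq> {j. \<tau> j \<noteq> j}" by metis
    qed
    moreover have "finite {j. \<tau> j \<noteq> j}"
      by (rule finite_subset[of _ "{1..n}"]) (use permutes_not_in[OF less.prems(1)] in blast, simp)
    ultimately have IH: "\<tau>' \<in> G \<and> (\<forall>f\<in>transposition_invariants. perm_act \<tau>' f = (f :: 'k mpoly))"
      using less.hyps[OF psubset_card_mono p b] by blast
    have "perm_act \<tau> f = f" if f: "f \<in> transposition_invariants" for f :: "'k mpoly"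
    proof -
      have "perm_act (transpose i (\<tau> i)) (perm_act \<tau>' f) = f"
        using IH f t i_in \<tau>i_in by (simp add: transposition_invariants_def)
      then show ?thesis by (simp add: perm_act_compose \<tau>[symmetric])
    qed
    moreover have "\<tau> \<in> G" by (subst \<tau>) (use comp_in t IH in blast)
    ultimately show ?thesis by blast
  qed
qed

definition block_sum :: "nat \<Rightarrow> 'k::comm_ring_1 mpoly" where
  "block_sum i = (\<Sum>j\<in>block i. Var j)"

definition block_prod :: "nat \<Rightarrow> 'k::comm_ring_1 mpoly" where
  "block_prod i = (\<Prod>j\<in>block i. Var j)"

lemma perm_act_block_sum:
  assumes "\<sigma> \<in> G" shows "perm_act \<sigma> (block_sum i) = block_sum (\<sigma> i)"
  unfolding block_sum_def using permutes_inj[OF permutes[OF assms]]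
  by (simp add: perm_act_hom perm_act_Var block_image[OF assms] sum.reindex inj_on_subset)

lemma perm_act_block_prod:
  assumes "\<sigma> \<in> G" shows "perm_act \<sigma> (block_prod i) = block_prod (\<sigma> i)"
  unfolding block_prod_def using permutes_inj[OF permutes[OF assms]]
  by (simp add: perm_act_hom perm_act_Var block_image[OF assms] prod.reindex inj_on_subset)

lemma block_transpose:
  assumes "transpose a b \<in> G" "a \<in> {1..n}" "b \<in> {1..n}"
  shows "block (transpose a b i) = block i"
proof -
  have "b \<in> block a" using assms by (simp add: block_def)
  then show ?thesis using block_eq by (auto simp: transpose_def)
qed

lemma block_sum_invariant: "block_sum i \<in> transposition_invariants"
proof -
  have "block_sum i \<in> polys n"
    by (simp add: polys_iff block_sum_def subst_hom restrict_vars_def block_def)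
  then show ?thesis
    by (auto simp: transposition_invariants_def perm_act_block_sum) (simp add: block_sum_def block_transpose)
qed

lemma block_prod_invariant: "block_prod i \<in> transposition_invariants"
proof -
  have "block_prod i \<in> polys n"
    by (simp add: polys_iff block_prod_def subst_hom restrict_vars_def block_def)
  then show ?thesis
    by (auto simp: transposition_invariants_def perm_act_block_prod) (simp add: block_prod_def block_transpose)
qed

lemma eval_block_sum:
  assumes "c \<in> {1..n}" "i \<in> {1..n}"
  shows "subst (\<lambda>j. if j = c then 1 else 0) (block_sum i) = (if block i = block c then 1 else 0)"
  using in_block_iff[OF assms(1), of i] finite_block by (auto simp: block_sum_def subst_hom)

text \<open>The form is linear and contains the variable \<open>i\<close> with coefficient one, so \<open>Var i\<close> can be eliminated
  modulo it.\<close>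
lemma prime_block_sum_diff:
  assumes i: "i \<in> {1..n}" and j: "j \<in> {1..n}" and ij: "block i \<noteq> block j"
  shows "prime_elem (block_sum i - block_sum j :: 'k::idom mpoly)"
proof -
  define l :: "'k mpoly" where "l = block_sum i - block_sum j"
  let ?y = "Var(i := Var i - l)"
  have "subst (\<lambda>k. if k = i then 1 else 0) l = 1"
    using i j ij by (simp add: l_def subst_diff eval_block_sum)
  then have "l \<noteq> 0" by (auto simp: subst_0)
  moreover have "l dvd ?y k - Var k" for k by simp
  moreover have "subst ?y l = 0"
  proof -
    have i_notin: "i \<notin> block j" using ij block_eq by blast
    have "subst ?y (block_sum j) = block_sum j"
      unfolding block_sum_def subst_sum subst_Var by (intro sum.cong) (use i_notin in auto)
    moreover have "subst ?y (block_sum i) = block_sum i - l"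
    proof -
      have "subst ?y (block_sum i) = (\<Sum>k\<in>block i. ?y k)"
        by (simp only: block_sum_def subst_sum subst_Var)
      also have "\<dots> = ?y i + (\<Sum>k\<in>block i - {i}. ?y k)"
        by (rule sum.remove[OF finite_block self_in_block[OF i]])
      also have "(\<Sum>k\<in>block i - {i}. ?y k) = (\<Sum>k\<in>block i - {i}. Var k)" by (intro sum.cong) auto
      also have "?y i + \<dots> = block_sum i - l"
        using sum.remove[OF finite_block self_in_block[OF i], of "Var :: nat \<Rightarrow> 'k mpoly"]
        by (simp add: block_sum_def)
      finally show ?thesis .
    qed
    ultimately show ?thesis unfolding subst_diff[of ?y "block_sum i" "block_sum j", folded l_def] by (simp add: l_def)
  qed
  ultimately show ?thesis unfolding l_def[symmetric] by (rule prime_elem_linear)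
qed

lemma not_dvd_eval:
  fixes l f :: "'k::idom mpoly"
  assumes "subst y l = 0" "subst y f \<noteq> 0" shows "\<not> l dvd f"
  using assms by (auto simp: subst_mult)

text \<open>No nontrivial element of the quotient fixes a hypersurface pointwise. The block sum of a moved
  block serves as \<open>w\<close>, except if \<open>\<sigma>\<close> only exchanges the blocks of \<open>i\<close> and \<open>j\<close>. In that case the
  block product serves as \<open>w\<close> if these blocks have at least two elements. If they are singletons, then
  \<open>\<sigma>\<close> is the transposition of \<open>i\<close> and \<open>j\<close> up to block-preserving permutations, so this transposition
  is in \<open>G\<close> and the blocks coincide. Non-divisibility is seen by evaluation at a zero of the linear
  form.\<close>
lemma avoid_block_sum_diff:
  assumes i: "i \<in> {1..n}" and j: "j \<in> {1..n}" and ij: "block i \<noteq> block j"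
    and \<sigma>: "\<sigma> \<in> G" and k: "k \<in> {1..n}" "\<sigma> k \<notin> block k"
  shows "\<exists>w\<in>transposition_invariants. \<not> (block_sum i - block_sum j :: 'k::idom mpoly) dvd perm_act \<sigma> w - w"
proof -
  let ?l = "block_sum i - block_sum j :: 'k mpoly"
  have bk: "block (\<sigma> m) = block m \<longleftrightarrow> \<sigma> m \<in> block m" if "m \<in> {1..n}" for m
    using in_block_iff[OF in_range[OF \<sigma> that], of m] by simp
  show ?thesis
  proof (cases "\<exists>m\<in>{1..n}. block (\<sigma> m) \<noteq> block m \<and> {block m, block (\<sigma> m)} \<noteq> {block i, block j}")
    case True
    then obtain m where m: "m \<in> {1..n}" "block (\<sigma> m) \<noteq> block m"
      "{block m, block (\<sigma> m)} \<noteq> {block i, block j}" by blast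
    have \<sigma>m: "\<sigma> m \<in> {1..n}" using in_range \<sigma> m(1) .
    obtain c where c: "c \<in> {m, \<sigma> m}" "block c \<noteq> block i" "block c \<noteq> block j" using m(2,3) by auto
    have cn: "c \<in> {1..n}" using c(1) m(1) \<sigma>m by blast
    let ?y = "\<lambda>k. if k = c then 1 else 0 :: 'k mpoly"
    have "\<not> ?l dvd perm_act \<sigma> (block_sum m) - block_sum m"
    proof (rule not_dvd_eval[of ?y])
      show "subst ?y ?l = 0"
        using c(2,3) cn i j by (simp add: subst_diff eval_block_sum)
      show "subst ?y (perm_act \<sigma> (block_sum m) - block_sum m) \<noteq> 0"
        using c(1) m(1,2) cn \<sigma>m
          by (auto simp: perm_act_block_sum[OF \<sigma>] subst_diff eval_block_sum)
    qed
    then show ?thesis using block_sum_invariant by blast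
  next
    case False
    have pair: "block (\<sigma> m) = block m \<or> {block m, block (\<sigma> m)} = {block i, block j}" if "m \<in> {1..n}" for m
      using False that by blast
    have swap: "block (\<sigma> i) = block j" "block (\<sigma> j) = block i"
    proof -
      have kk: "{block k, block (\<sigma> k)} = {block i, block j}" using pair[OF k(1)] k bk by blast
      have "block k = block i \<and> block (\<sigma> k) = block j \<or> block k = block j \<and> block (\<sigma> k) = block i"
        using kk by (auto simp: doubleton_eq_iff)
      then have "block (\<sigma> i) = block j \<or> block (\<sigma> j) = block i"
        using block_image_eq_iff[OF \<sigma>] i j k(1) by metis
      then show "block (\<sigma> i) = block j" "block (\<sigma> j) = block i"
        using pair[OF i] pair[OF j] ij block_image_eq_iff[OF \<sigma> i j] by (auto simp: doubleton_eq_iff)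
    qed
    have disj: "block i \<inter> block j = {}" using ij block_eq by blast
    have bj: "block j = \<sigma> ` block i" using block_image[OF \<sigma>] swap by simp
    have inj: "\<sigma> a = \<sigma> b \<longleftrightarrow> a = b" for a b using permutes_inj[OF permutes[OF \<sigma>]] by (simp add: inj_eq)
    show ?thesis
    proof (cases "block i = {i}")
      case False
      then obtain i' where i': "i' \<in> block i" "i' \<noteq> i" using self_in_block[OF i] by blast
      have "\<exists>j'\<in>block j. j' \<noteq> j"
      proof (cases "\<sigma> i = j")
        case True
        then show ?thesis using i' inj by (auto simp: bj)
      next
        case False
        then show ?thesis using self_in_block[OF i] by (auto simp: bj)
      qed
      then obtain j' where j': "j' \<in> block j" "j' \<noteq> j" by blast
      \<comment> \<open>Both blocks have sum \<open>card (block i)\<close> at this point, but the products are one and zero.\<close>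
      let ?y = "\<lambda>m. if m \<in> block i then 1 else if m = j then of_nat (card (block i)) else 0 :: 'k mpoly"
      have si: "(\<Sum>m\<in>block i. ?y m) = of_nat (card (block i))" by simp
      have sj: "(\<Sum>m\<in>block j. ?y m) = of_nat (card (block i))"
      proof -
        have "(\<Sum>m\<in>block j. ?y m) = (\<Sum>m\<in>block j. if m = j then of_nat (card (block i)) else 0)"
          using disj by (intro sum.cong) auto
        then show ?thesis using finite_block self_in_block[OF j] by simp
      qed
      have pi: "(\<Prod>m\<in>block i. ?y m) = 1" by simp
      have pj: "(\<Prod>m\<in>block j. ?y m) = 0"
        using finite_block j' disj by (intro prod_zero) auto
      have w: "perm_act \<sigma> (block_prod i) = (block_prod j :: 'k mpoly)"
        unfolding perm_act_block_prod[OF \<sigma>] by (simp add: block_prod_def swap)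
      have "\<not> ?l dvd perm_act \<sigma> (block_prod i) - block_prod i"
      proof (rule not_dvd_eval[of ?y])
        show "subst ?y ?l = 0"
          unfolding block_sum_def subst_diff subst_sum subst_Var si sj by simp
        show "subst ?y (perm_act \<sigma> (block_prod i) - block_prod i) \<noteq> 0"
          unfolding w unfolding block_prod_def subst_diff subst_prod subst_Var pi pj by simp
      qed
      then show ?thesis using block_prod_invariant by blast
    next
      case True
      then have \<sigma>i: "\<sigma> i = j" and bj': "block j = {j}" using bj self_in_block[OF j] by auto
      have \<sigma>j: "\<sigma> j = i" using swap(2) True self_in_block[OF in_range[OF \<sigma> j]] by auto
      define \<tau> where "\<tau> = transpose i j \<circ> \<sigma>"
      have "\<tau> \<in> G \<and> (\<forall>f\<in>transposition_invariants. perm_act \<tau> f = (f :: 'k mpoly))"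
      proof (rule blockwise_trivial)
        show "\<tau> permutes {1..n}"
          unfolding \<tau>_def by (rule permutes_compose[OF permutes[OF \<sigma>] permutes_swap_id]) (use i j in auto)
        fix m assume m: "m \<in> {1..n}"
        show "\<tau> m \<in> block m"
        proof (cases "m = i \<or> m = j")
          case True
          then show ?thesis using \<sigma>i \<sigma>j self_in_block i j by (auto simp: \<tau>_def)
        next
          case False
          then have "block m \<noteq> block i" "block m \<noteq> block j"
            using self_in_block[OF m] True bj' by auto
          then have "\<sigma> m \<in> block m" using pair[OF m] bk[OF m] by (auto simp: doubleton_eq_iff)
          moreover have "\<sigma> m \<noteq> i" "\<sigma> m \<noteq> j" using False inj \<sigma>i \<sigma>j by metis+
          ultimately show ?thesis by (simp add: \<tau>_def)
        qed
      qed
      moreover have "transpose i j = \<tau> \<circ> inv' \<sigma>"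
        using permutes_inv_o(1)[OF permutes[OF \<sigma>]] by (simp add: \<tau>_def comp_assoc)
      ultimately have "transpose i j \<in> G" using comp_in inv_in \<sigma> by metis
      then have "j \<in> block i" using j by (simp add: block_def)
      then show ?thesis using block_eq ij by blast
    qed
  qed
qed


abbreviation restricted :: "(nat \<Rightarrow> nat) \<Rightarrow> 'k::comm_ring_1 mpoly \<Rightarrow> 'k mpoly" where
  "restricted \<sigma> \<equiv> restrict (perm_act \<sigma>) transposition_invariants"

lemma perm_act_invariant:
  assumes "\<sigma> \<in> G" "f \<in> transposition_invariants"
  shows "perm_act \<sigma> f \<in> transposition_invariants"
proof -
  have f: "f \<in> polys n" using assms(2) by (simp add: transposition_invariants_def)
  have "perm_act \<sigma> f \<in> polys n"
    unfolding perm_act_def using in_range[OF assms(1)] by (intro subst_polys[OF f] polys_closed) auto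
  moreover have "perm_act (transpose i j) (perm_act \<sigma> f) = perm_act \<sigma> f"
    if ij: "i \<in> {1..n}" "j \<in> {1..n}" "transpose i j \<in> G" for i j
  proof -
    have s: "\<sigma> permutes {1..n}" using permutes assms(1) .
    obtain i' j' where i'j': "i = \<sigma> i'" "j = \<sigma> j'" using s by (metis permutes_surj surjD)
    have t: "transpose i' j' \<in> G" using ij(3) transpose_conj[OF assms(1)] by (simp add: i'j')
    have "i' \<in> {1..n}" "j' \<in> {1..n}" using ij permutes_in_image[OF s] by (simp_all add: i'j')
    then have f': "perm_act (transpose i' j') f = f"
      using assms(2) t by (simp add: transposition_invariants_def)
    have "transpose i j \<circ> \<sigma> = \<sigma> \<circ> transpose i' j'"
      using permutes_inj[OF s] by (auto simp: i'j' fun_eq_iff transpose_def inj_eq)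
    then have "perm_act (transpose i j) (perm_act \<sigma> f) = perm_act \<sigma> (perm_act (transpose i' j') f)"
      by (simp add: perm_act_compose)
    then show ?thesis by (simp add: f')
  qed
  ultimately show ?thesis by (simp add: transposition_invariants_def)
qed

text \<open>The fibres of \<open>restricted\<close> are the cosets of the kernel \<open>K\<close> of the action.\<close>
lemma card_restricted_dvd:
  "card ((restricted :: _ \<Rightarrow> 'k::comm_ring_1 mpoly \<Rightarrow> _) ` G) dvd card G"
proof -
  let ?R = "transposition_invariants :: 'k mpoly set"
  let ?h = "restricted :: _ \<Rightarrow> 'k mpoly \<Rightarrow> 'k mpoly"
  define K where "K = {\<kappa> \<in> G. \<forall>f\<in>?R. perm_act \<kappa> f = f}"
  have fiber: "card {\<sigma> \<in> G. ?h \<sigma> = ?h \<tau>} = card K" if \<tau>: "\<tau> \<in> G" for \<tau>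
  proof -
    have p: "\<tau> permutes {1..n}" using permutes \<tau> .
    have "{\<sigma> \<in> G. ?h \<sigma> = ?h \<tau>} = (\<lambda>\<kappa>. \<tau> \<circ> \<kappa>) ` K"
    proof (intro equalityI subsetI)
      fix \<sigma> assume \<sigma>: "\<sigma> \<in> {\<sigma> \<in> G. ?h \<sigma> = ?h \<tau>}"
      have "perm_act \<sigma> f = perm_act \<tau> f" if "f \<in> ?R" for f
        using \<sigma> that by (metis (mono_tags, lifting) mem_Collect_eq restrict_apply')
      then have "perm_act (inv' \<tau> \<circ> \<sigma>) f = f" if "f \<in> ?R" for f
        using that permutes_inv_o(2)[OF p] by (simp add: perm_act_compose[symmetric])
          (simp add: perm_act_compose perm_act_id)
      then have "inv' \<tau> \<circ> \<sigma> \<in> K" using \<sigma> \<tau> inv_in comp_in by (simp add: K_def)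
      moreover have "\<sigma> = \<tau> \<circ> (inv' \<tau> \<circ> \<sigma>)"
        using permutes_inv_o(1)[OF p] by (simp add: comp_assoc[symmetric])
      ultimately show "\<sigma> \<in> (\<lambda>\<kappa>. \<tau> \<circ> \<kappa>) ` K" by blast
    next
      fix \<sigma> assume "\<sigma> \<in> (\<lambda>\<kappa>. \<tau> \<circ> \<kappa>) ` K"
      then show "\<sigma> \<in> {\<sigma> \<in> G. ?h \<sigma> = ?h \<tau>}"
        using \<tau> comp_in by (auto simp: K_def perm_act_compose[symmetric] intro!: restrict_ext)
    qed
    moreover have "inj_on (\<lambda>\<kappa>. \<tau> \<circ> \<kappa>) K"
    proof (rule inj_onI)
      fix \<kappa> \<kappa>' assume "\<tau> \<circ> \<kappa> = \<tau> \<circ> \<kappa>'"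
      then have "inv' \<tau> \<circ> (\<tau> \<circ> \<kappa>) = inv' \<tau> \<circ> (\<tau> \<circ> \<kappa>')" by simp
      then show "\<kappa> = \<kappa>'" by (simp only: comp_assoc[symmetric] permutes_inv_o(2)[OF p] id_comp)
    qed
    ultimately show ?thesis by (simp add: card_image)
  qed
  have "card G = (\<Sum>q\<in>?h ` G. \<Sum>\<sigma>\<in>{\<sigma> \<in> G. ?h \<sigma> = q}. 1)"
    using sum.image_gen[OF finite_G, of "\<lambda>_. 1 :: nat" ?h] by (simp only: card_eq_sum)
  also have "\<dots> = (\<Sum>q\<in>?h ` G. card K)" using fiber by (intro sum.cong) auto
  finally show ?thesis by simp
qed

lemma finite_ring_action_restricted:
  "finite_ring_action transposition_invariants
     (restricted ` G :: ('k::idom mpoly \<Rightarrow> 'k mpoly) set) (restricted id)"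
proof
  let ?R = "transposition_invariants :: 'k mpoly set"
  note R = transposition_invariants_def
  show "1 \<in> ?R" using polys_closed(1)[of 1 n] by (simp add: R perm_act_hom Const_hom)
  show "f - g \<in> ?R" "f * g \<in> ?R" if "f \<in> ?R" "g \<in> ?R" for f g
    using that by (simp_all add: R perm_act_hom polys_closed)
  show "f \<in> ?R" if d: "d \<in> ?R" "d \<noteq> 0" "d * f \<in> ?R" for d f
  proof -
    have "d * subst (restrict_vars n) f = d * f" using d(1,3) by (simp add: R polys_iff subst_mult)
    moreover have "d * perm_act (transpose i j) f = d * f"
      if "i \<in> {1..n}" "j \<in> {1..n}" "transpose i j \<in> G" for i j
      using d(1,3) that by (simp add: R perm_act_hom)
    ultimately show ?thesis using d(2) by (simp add: R polys_iff)
  qed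
  show "finite (restricted ` G :: ('k mpoly \<Rightarrow> 'k mpoly) set)" using finite_G by simp
  show "restricted id \<in> (restricted ` G :: ('k mpoly \<Rightarrow> 'k mpoly) set)" using id_in by blast
  show "restricted id f = f" if "f \<in> ?R" for f using that by (simp add: perm_act_id)
  fix q assume "q \<in> (restricted ` G :: ('k mpoly \<Rightarrow> 'k mpoly) set)"
  then obtain \<sigma> where \<sigma>: "\<sigma> \<in> G" "q = restricted \<sigma>" by blast
  show "q f \<in> ?R" if "f \<in> ?R" for f using that \<sigma> perm_act_invariant by simp
  show "q (f - g) = q f - q g" "q (f * g) = q f * q g" if "f \<in> ?R" "g \<in> ?R" for f g
    using that \<sigma> by (simp_all add: perm_act_hom R polys_closed)
  show "q 1 = 1" using \<open>1 \<in> ?R\<close> \<sigma> by (simp add: perm_act_hom)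
  let ?\<pi> = "\<lambda>q'. compose ?R q q'"
  have \<pi>: "?\<pi> (restricted \<tau>) = restricted (\<sigma> \<circ> \<tau>)" if "\<tau> \<in> G" for \<tau>
    using perm_act_invariant[OF that, where 'a = 'k] by (auto simp: \<sigma> compose_def perm_act_compose intro!: restrict_ext)
  have "restricted ` G \<subseteq> ?\<pi> ` (restricted ` G)"
  proof
    fix q' assume "q' \<in> (restricted ` G :: ('k mpoly \<Rightarrow> 'k mpoly) set)"
    then obtain \<tau> where \<tau>: "\<tau> \<in> G" "q' = restricted \<tau>" by blast
    have "\<sigma> \<circ> (inv' \<sigma> \<circ> \<tau>) = \<tau>"
      using permutes_inv_o(1)[OF permutes[OF \<sigma>(1)]] by (simp add: comp_assoc[symmetric])
    then have "q' = ?\<pi> (restricted (inv' \<sigma> \<circ> \<tau>))"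
      using \<pi>[of "inv' \<sigma> \<circ> \<tau>"] \<tau> \<sigma>(1) inv_in comp_in by simp
    then show "q' \<in> ?\<pi> ` (restricted ` G)" using \<tau>(1) \<sigma>(1) inv_in comp_in by blast
  qed
  moreover have "?\<pi> ` (restricted ` G) \<subseteq> restricted ` G"
    using \<pi> \<sigma>(1) comp_in by auto
  ultimately have im: "?\<pi> ` (restricted ` G) = restricted ` G" by blast
  then have "inj_on ?\<pi> (restricted ` G)"
    using finite_G by (intro eq_card_imp_inj_on) auto
  then have "bij_betw ?\<pi> (restricted ` G) (restricted ` G)" using im by (simp add: bij_betw_def)
  then show "\<exists>\<pi>. bij_betw \<pi> (restricted ` G) (restricted ` G) \<and>
      (\<forall>q'\<in>restricted ` G. \<forall>f\<in>?R. q (q' f) = \<pi> q' f)"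
    by (intro exI[of _ ?\<pi>]) (simp add: compose_def)
qed

lemma invariants_subset: "invariants n G \<subseteq> transposition_invariants"
  by (auto simp: invariants_def transposition_invariants_def)

text \<open>Otherwise the group \<open>Q\<close> of restrictions is nontrivial, so that \<open>p\<close> divides its order. All elements
  of \<open>Q\<close> preserve constant terms, so every trace has constant term zero, whereas the splitting
  gives an element of trace one.\<close>
lemma splitting_imp_blockwise:
  assumes p: "p > 0" "CHAR('k::field) = p" "card G = p ^ e"
    and split: "inclusion_splits (invariants n G) (polys n :: 'k mpoly set)"
    and \<sigma>: "\<sigma> \<in> G" and i: "i \<in> {1..n}"
  shows "\<sigma> i \<in> block i"
proof (rule ccontr)
  assume notin: "\<sigma> i \<notin> block i"
  let ?R = "transposition_invariants :: 'k mpoly set"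
  let ?Q = "restricted ` G :: ('k mpoly \<Rightarrow> 'k mpoly) set"
  let ?e = "restricted id :: 'k mpoly \<Rightarrow> 'k mpoly"
  interpret A: finite_ring_action ?R ?Q ?e by (rule finite_ring_action_restricted)
  have fixed: "A.fixed = invariants n G"
  proof -
    have "A.fixed = {f \<in> ?R. \<forall>\<tau>\<in>G. perm_act \<tau> f = f}" by (auto simp: A.fixed_def)
    also have "\<dots> = invariants n G"
      by (auto simp: invariants_def transposition_invariants_def)
    finally show ?thesis .
  qed
  have R_polys: "?R \<subseteq> polys n" by (auto simp: transposition_invariants_def)
  obtain \<rho> where \<rho>: "\<forall>f\<in>polys n. \<rho> f \<in> invariants n G"
     "\<forall>f\<in>polys n. \<forall>g\<in>polys n. \<rho> (f + g) = \<rho> f + \<rho> g"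
     "\<forall>r\<in>invariants n G. \<forall>f\<in>polys n. \<rho> (r * f) = r * \<rho> f"
     "\<forall>r\<in>invariants n G. \<rho> r = (r :: 'k mpoly)"
    using split unfolding inclusion_splits_def by blast
  have moves: "\<exists>\<tau>\<in>G. q = restricted \<tau> \<and> (\<exists>k\<in>{1..n}. \<tau> k \<notin> block k)" if q: "q \<in> ?Q - {?e}" for q
  proof -
    obtain \<tau> where \<tau>: "\<tau> \<in> G" "q = restricted \<tau>" using q by blast
    have "\<exists>k\<in>{1..n}. \<tau> k \<notin> block k"
    proof (rule ccontr)
      assume "\<not> (\<exists>k\<in>{1..n}. \<tau> k \<notin> block k)"
      then have "\<forall>f\<in>?R. perm_act \<tau> f = f"
        using blockwise_trivial[OF permutes[OF \<tau>(1)]] by blast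
      then have "q = ?e" unfolding \<tau>(2) by (intro restrict_ext) (simp add: perm_act_id)
      then show False using q by blast
    qed
    then show ?thesis using \<tau> by blast
  qed
  have "\<exists>k k'. k \<in> {1..n} \<and> k' \<in> {1..n} \<and> block k' \<noteq> block k \<and> q (block_sum k) = block_sum k'"
    if q: "q \<in> ?Q - {?e}" for q
  proof -
    obtain \<tau> k where \<tau>: "\<tau> \<in> G" "q = restricted \<tau>" "k \<in> {1..n}" "\<tau> k \<notin> block k"
      using moves[OF q] by blast
    have "q (block_sum k) = block_sum (\<tau> k)"
      by (simp add: \<tau>(2) block_sum_invariant perm_act_block_sum[OF \<tau>(1)])
    then show ?thesis
      using in_range[OF \<tau>(1,3)] in_block_iff[of "\<tau> k" k] \<tau>(3,4)
      by (intro exI[of _ k] exI[of _ "\<tau> k"]) simp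
  qed
  then obtain k k' where k: "\<And>q. q \<in> ?Q - {?e} \<Longrightarrow> k q \<in> {1..n} \<and> k' q \<in> {1..n} \<and>
      block (k' q) \<noteq> block (k q) \<and> q (block_sum (k q)) = block_sum (k' q)"
    by metis
  have "\<exists>a\<in>?R. A.trace a = 1"
  proof (rule A.splitting_imp_trace_one[of \<rho> "\<lambda>q. block_sum (k q)"])
    show "\<rho> f \<in> A.fixed" if "f \<in> ?R" for f using that \<rho>(1) R_polys fixed by blast
    show "\<rho> (f + g) = \<rho> f + \<rho> g" if "f \<in> ?R" "g \<in> ?R" for f g using that \<rho>(2) R_polys by blast
    show "\<rho> (r * f) = r * \<rho> f" if "r \<in> A.fixed" "f \<in> ?R" for r f using that \<rho>(3) R_polys fixed by blast
    show "\<rho> r = r" if "r \<in> A.fixed" for r using that \<rho>(4) fixed by blast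
    show "block_sum (k q) \<in> ?R" for q by (rule block_sum_invariant)
    show "prime_elem (q (block_sum (k q)) - block_sum (k q))" if "q \<in> ?Q - {?e}" for q
      using k[OF that] prime_block_sum_diff[of "k' q" "k q", where 'k = 'k] by simp
    fix q q' assume q: "q \<in> ?Q - {?e}" and q': "q' \<in> ?Q - {?e}"
    obtain \<tau> m where \<tau>: "\<tau> \<in> G" "q' = restricted \<tau>" "m \<in> {1..n}" "\<tau> m \<notin> block m"
      using moves[OF q'] by blast
    have kq: "k' q \<in> {1..n}" "k q \<in> {1..n}" "block (k' q) \<noteq> block (k q)"
      "q (block_sum (k q)) = block_sum (k' q)" using k[OF q] by auto
    obtain w where w: "w \<in> ?R" "\<not> (block_sum (k' q) - block_sum (k q)) dvd perm_act \<tau> w - w"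
      using avoid_block_sum_diff[OF kq(1-3) \<tau>(1,3,4)] by blast
    show "\<exists>w\<in>?R. \<not> (q (block_sum (k q)) - block_sum (k q)) dvd q' w - w"
      by (rule bexI[of _ w]) (use w in \<open>simp_all only: kq(4) \<tau>(2) restrict_apply' simp_thms\<close>)
  qed
  then obtain a where a: "a \<in> ?R" "A.trace a = 1" by blast
  \<comment> \<open>Evaluation at the origin, that is, the constant term.\<close>
  let ?\<epsilon> = "subst (\<lambda>_. 0) :: 'k mpoly \<Rightarrow> 'k mpoly"
  have "?\<epsilon> (perm_act \<tau> f) = ?\<epsilon> f" for \<tau> f by (simp add: perm_act_def subst_subst subst_Var)
  then have "?\<epsilon> (A.trace a) = (\<Sum>q\<in>?Q. ?\<epsilon> a)"
    unfolding A.trace_def subst_sum using a(1) by (intro sum.cong) auto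
  then have "1 = of_nat (card ?Q) * ?\<epsilon> a" by (simp only: a(2) subst_1 sum_constant)
  moreover have "of_nat (card ?Q) = (0 :: 'k mpoly)"
  proof -
    have "prime p" using p(1,2) prime_CHAR_semidom[where ?'a = 'k] by simp
    moreover have "card ?Q dvd p ^ e" using card_restricted_dvd[where 'k = 'k] unfolding p(3) .
    moreover have "card ?Q \<noteq> 1"
    proof
      assume "card ?Q = 1"
      moreover have "restricted \<sigma> \<in> ?Q" "?e \<in> ?Q" using \<sigma> id_in by blast+
      ultimately have "restricted \<sigma> = ?e" by (metis card_1_singletonE singletonD)
      then have "restricted \<sigma> (block_sum i) = ?e (block_sum i)" by simp
      then have same: "block_sum (\<sigma> i) = (block_sum i :: 'k mpoly)"
        by (simp add: block_sum_invariant perm_act_block_sum[OF \<sigma>] perm_act_id)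
      let ?y = "\<lambda>j. if j = i then 1 else 0 :: 'k mpoly"
      have "(if block (\<sigma> i) = block i then 1 else 0) = subst ?y (block_sum (\<sigma> i))"
        by (rule eval_block_sum[OF i in_range[OF \<sigma> i], symmetric])
      also have "\<dots> = subst ?y (block_sum i)" by (simp only: same)
      also have "\<dots> = 1" unfolding eval_block_sum[OF i i] by simp
      finally have "(if block (\<sigma> i) = block i then 1 else 0) = (1 :: 'k mpoly)" .
      then have "block (\<sigma> i) = block i" by (simp split: if_splits)
      then show False using notin in_block_iff[OF in_range[OF \<sigma> i], of i] by simp
    qed
    ultimately obtain r where "card ?Q = p ^ r" "r \<noteq> 0"
      using divides_primepow_nat[of p "card ?Q" e] by (metis power_0)
    then have "p dvd card ?Q" by simp
    then have "of_nat (card ?Q) = (0 :: 'k)" by (simp only: of_nat_eq_0_iff_char_dvd p(2))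
    then show ?thesis by (simp only: Const_of_nat[symmetric] Const_hom)
  qed
  ultimately have "1 = (0 :: 'k mpoly)" by (simp only: mult_zero_left)
  then show False by simp
qed

text \<open>A transposition has order 2 and the product of two overlapping ones has order 3, so that both 2
  and 3 would divide the order of a \<open>p\<close>-group.\<close>
lemma transpositions_disjoint:
  assumes p: "prime p" "card G = p ^ e"
    and t: "transpose x y \<in> G" "transpose x z \<in> G" and d: "x \<noteq> y" "x \<noteq> z"
  shows "y = z"
proof (rule ccontr)
  assume yz: "y \<noteq> z"
  have dvd: "q = p" if "prime q" "q dvd card G" for q
    using that p by (metis prime_dvd_power primes_dvd_imp_eq)
  have even: "2 dvd card G"
  proof (rule ccontr)
    assume "\<not> 2 dvd card G"
    then obtain m where m: "card G = 2 * m + 1" by (metis oddE)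
    have "transpose x y ^^ 2 = id" by (simp add: numeral_2_eq_2)
    then have "transpose x y ^^ (2 * m) = id" by (simp only: funpow_mult[symmetric] id_funpow)
    then have "transpose x y ^^ card G = transpose x y" by (simp add: m)
    then show False using power_card[OF t(1)] d(1) by (metis transpose_eq_id_iff)
  qed
  define c where "c = transpose x y \<circ> transpose x z"
  have c: "c x = z" "c z = y" "c y = x" using d yz by (simp_all add: c_def transpose_def)
  have "(c ^^ 3) x = x" by (simp add: c eval_nat_numeral)
  then have c3: "((c ^^ 3) ^^ m) x = x" for m by (induction m) simp_all
  have "3 dvd card G"
  proof (rule ccontr)
    assume n3: "\<not> 3 dvd card G"
    have "(c ^^ card G) x = x" using power_card[OF comp_in[OF t]] by (simp add: c_def)
    moreover have "c ^^ card G = c ^^ (card G mod 3) \<circ> (c ^^ 3) ^^ (card G div 3)"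
      by (simp add: funpow_mult funpow_add[symmetric])
    ultimately have r: "(c ^^ (card G mod 3)) x = x" using c3 by simp
    have "card G mod 3 = 1 \<or> card G mod 3 = 2" using n3 by presburger
    then show False
    proof
      assume "card G mod 3 = 1"
      then show False using r c(1) d by simp
    next
      assume "card G mod 3 = 2"
      then show False using r c(1,2) d by (simp add: numeral_2_eq_2)
    qed
  qed
  then show False using dvd[of 3] dvd[of 2] even by simp
qed

lemma polynomial_ring_transposition_invariants:
  assumes p: "prime p" "card G = p ^ e"
  shows "is_polynomial_ring (transposition_invariants :: 'k::idom mpoly set)"
proof -
  define P where "P = {(a, b) \<in> {1..n} \<times> {1..n}. a < b \<and> transpose a b \<in> G}"
  have "transposition_invariants =
      {f \<in> polys n. \<forall>(a, b)\<in>P. perm_act (transpose a b) f = (f :: 'k mpoly)}" (is "?R = ?I")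
  proof (intro equalityI subsetI)
    fix f assume "f \<in> ?R"
    then show "f \<in> ?I" by (auto simp: transposition_invariants_def P_def)
  next
    fix f assume f: "f \<in> ?I"
    have "perm_act (transpose i j) f = f" if ij: "i \<in> {1..n}" "j \<in> {1..n}" "transpose i j \<in> G" for i j
    proof -
      consider "i = j" | "(i, j) \<in> P" | "(j, i) \<in> P"
        using ij by (auto simp: P_def transpose_commute) (metis nat_neq_iff transpose_commute)
      then show ?thesis using f perm_act_id by cases (auto simp: transpose_commute)
    qed
    then show "f \<in> ?R" using f by (auto simp: transposition_invariants_def)
  qed
  moreover have "\<exists>\<phi>. k_algebra_iso \<phi> (polys n) ?I"
  proof (rule invariants_disjoint_transpositions)
    show "finite P" unfolding P_def by (rule finite_subset[of _ "{1..n} \<times> {1..n}"]) auto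
    show "a \<noteq> b \<and> a \<in> {1..n} \<and> b \<in> {1..n}" if "(a, b) \<in> P" for a b using that by (auto simp: P_def)
    fix a b c d assume ab: "(a, b) \<in> P" and cd: "(c, d) \<in> P" and ne: "(a, b) \<noteq> (c, d)"
    have t: "transpose a b \<in> G" "transpose b a \<in> G" "transpose c d \<in> G" "transpose d c \<in> G" "a < b" "c < d"
      using ab cd by (auto simp: P_def transpose_commute)
    show "{a, b} \<inter> {c, d} = {}"
    proof (rule ccontr)
      assume "{a, b} \<inter> {c, d} \<noteq> {}"
      then consider "a = c" | "a = d" | "b = c" | "b = d" by blast
      then show False
      proof cases
        case 1
        then show ?thesis using transpositions_disjoint[OF p, of a b d] t ne by simp
      next
        case 2
        then show ?thesis using transpositions_disjoint[OF p, of a b c] t by simp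
      next
        case 3
        then show ?thesis using transpositions_disjoint[OF p, of b a d] t by simp
      next
        case 4
        then show ?thesis using transpositions_disjoint[OF p, of b a c] t ne by simp
      qed
    qed
  qed
  ultimately show ?thesis unfolding is_polynomial_ring_def by metis
qed

end

theorem corollary7p2:
  fixes n p :: nat and G :: "(nat \<Rightarrow> nat) set"
  assumes "p > 0" and "CHAR('k::field) = p"
    and "subgroup G (sym_group n)"
    and "\<exists>e. card G = p ^ e"
    and "inclusion_splits (invariants n G) (polys n :: 'k mpoly set)"
  shows "is_polynomial_ring (invariants n G :: 'k mpoly set)"
proof -
  interpret permutation_subgroup n G by (rule permutation_subgroup.intro) (rule assms(3))
  obtain e where e: "card G = p ^ e" using assms(4) by blast
  have "prime p" using assms(1,2) prime_CHAR_semidom[where ?'a = 'k] by simp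
  have "transposition_invariants \<subseteq> (invariants n G :: 'k mpoly set)"
  proof
    fix f :: "'k mpoly" assume f: "f \<in> transposition_invariants"
    have "perm_act \<sigma> f = f" if "\<sigma> \<in> G" for \<sigma>
      using blockwise_trivial[OF permutes[OF that]] splitting_imp_blockwise[OF assms(1,2) e assms(5) that] f
      by blast
    then show "f \<in> invariants n G" using f by (simp add: invariants_def transposition_invariants_def)
  qed
  then have "invariants n G = (transposition_invariants :: 'k mpoly set)"
    using invariants_subset by blast
  then show ?thesis using polynomial_ring_transposition_invariants[OF \<open>prime p\<close> e, where 'k = 'k] by simp
qed

end
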